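(* Let $A, B \in \mathbb{P}$ and $t \in (0,1]$. If $A^{-1} \natural_{t} B \leq A^{-1}$, then $A^{p} \# B^{p} \leq I$ for any $p \geq 1$.
   Context: $\mathcal{H}$ is a Hilbert space, $B(\mathcal{H})$ is the space of bounded linear operators on $\mathcal{H}$, $I$ is the identity operator, and $\mathbb{P} \subset B(\mathcal{H})$ is the open convex cone of positive definite (that is, self-adjoint, positive and invertible) operators. For self-adjoint $X, Y$, $X \leq Y$ means that $Y - X$ is positive semi-definite (Loewner order). For $A, B \in \mathbb{P}$ the geometric mean is $A \# B := A^{1/2} (A^{-1/2} B A^{-1/2})^{1/2} A^{1/2}$. For $t \in [0,1]$ the weighted spectral geometric mean is $A \natural_{t} B := (A^{-1} \# B)^{t} A (A^{-1} \# B)^{t}$. Real powers of positive definite operators are taken by functional calculus. *)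

theory Defs
  imports "HOL-Analysis.Analysis" "HOL-Computational_Algebra.Polynomial"
begin

(* The distribution has no complex inner product spaces.  A complex Hilbert space is given here
   as a complete real_inner space (which supplies norm, metric and topology) together with a
   compatible complex scalar multiplication and a sesquilinear form, linear in the first argument,
   whose real part is the real inner product; in particular norm x ^ 2 = cinner x x. *)

class complex_inner = real_inner +
  fixes scaleC :: "complex \<Rightarrow> 'a \<Rightarrow> 'a" (infixr "*\<^sub>C" 75)
    and cinner :: "'a \<Rightarrow> 'a \<Rightarrow> complex"
  assumes scaleC_add_right: "c *\<^sub>C (x + y) = c *\<^sub>C x + c *\<^sub>C y"
    and scaleC_add_left: "(c + d) *\<^sub>C x = c *\<^sub>C x + d *\<^sub>C x"
    and scaleC_scaleC: "c *\<^sub>C d *\<^sub>C x = (c * d) *\<^sub>C x"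
    and scaleR_scaleC: "scaleR r x = complex_of_real r *\<^sub>C x"
    and cinner_commute: "cinner x y = cnj (cinner y x)"
    and cinner_add_left: "cinner (x + y) z = cinner x z + cinner y z"
    and cinner_scaleC_left: "cinner (c *\<^sub>C x) y = c * cinner x y"
    and inner_cinner: "inner x y = Re (cinner x y)"

class chilbert_space = complex_inner + complete_space
begin
subclass banach ..
end

lemma norm_scaleC: "norm (c *\<^sub>C x) = cmod c * norm (x :: 'a::complex_inner)"
proof -
  have right: "cinner x (c *\<^sub>C x) = cnj c * cinner x x"
    by (metis cinner_commute cinner_scaleC_left complex_cnj_mult)
  have "Im (cinner x x) = 0"
    by (metis cinner_commute cnj.simps(2) equal_neg_zero)
  then have real: "cinner x x = of_real (inner x x)"
    by (simp add: complex_eq_iff inner_cinner)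
  have "cinner (c *\<^sub>C x) (c *\<^sub>C x) = (c * cnj c) * of_real (inner x x)"
    by (simp add: cinner_scaleC_left right real)
  then have "cinner (c *\<^sub>C x) (c *\<^sub>C x) = of_real ((cmod c)\<^sup>2 * inner x x)"
    by (simp only: complex_norm_square of_real_mult)
  then have "inner (c *\<^sub>C x) (c *\<^sub>C x) = (cmod c)\<^sup>2 * inner x x"
    by (simp add: inner_cinner)
  then show ?thesis
    by (simp add: norm_eq_sqrt_inner real_sqrt_mult)
qed

lemma bounded_linear_scaleC: "bounded_linear ((*\<^sub>C) c :: 'a::complex_inner \<Rightarrow> 'a)"
  by (rule bounded_linear_intro[where K = "cmod c"])
    (simp_all add: scaleC_add_right scaleR_scaleC scaleC_scaleC norm_scaleC mult.commute)

(* The library type of bounded operators consists of the real-linear ones; B(H) is this subset. *)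

definition bounded_ops :: "('a::chilbert_space \<Rightarrow>\<^sub>L 'a) set" where
  "bounded_ops = {A :: 'a \<Rightarrow>\<^sub>L 'a. \<forall>c x. A (c *\<^sub>C x) = c *\<^sub>C A x}"

definition scalar_op :: "complex \<Rightarrow> 'a::chilbert_space \<Rightarrow>\<^sub>L 'a" where
  "scalar_op c = Blinfun ((*\<^sub>C) c)"

lemma scalar_op_apply [simp]: "scalar_op c x = c *\<^sub>C x"
  by (simp add: scalar_op_def bounded_linear_Blinfun_apply bounded_linear_scaleC)

definition is_inverse :: "('a::chilbert_space \<Rightarrow>\<^sub>L 'a) \<Rightarrow> ('a \<Rightarrow>\<^sub>L 'a) \<Rightarrow> bool" where
  "is_inverse A C \<longleftrightarrow> C \<in> bounded_ops \<and> A o\<^sub>L C = id_blinfun \<and> C o\<^sub>L A = id_blinfun"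

definition invertible_op :: "('a::chilbert_space \<Rightarrow>\<^sub>L 'a) \<Rightarrow> bool" where
  "invertible_op A \<longleftrightarrow> (\<exists>C. is_inverse A C)"

definition op_inv :: "('a::chilbert_space \<Rightarrow>\<^sub>L 'a) \<Rightarrow> 'a \<Rightarrow>\<^sub>L 'a" where
  "op_inv A = (THE C. is_inverse A C)"

definition spectrum :: "('a::chilbert_space \<Rightarrow>\<^sub>L 'a) \<Rightarrow> complex set" where
  "spectrum A = {z. \<not> invertible_op (A - scalar_op z)}"

definition self_adjoint :: "('a::chilbert_space \<Rightarrow>\<^sub>L 'a) \<Rightarrow> bool" where
  "self_adjoint A \<longleftrightarrow> A \<in> bounded_ops \<and> (\<forall>x y. cinner (A x) y = cinner x (A y))"

(* cinner (A x) x is real for self-adjoint A. *)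
definition pos_semidef :: "('a::chilbert_space \<Rightarrow>\<^sub>L 'a) \<Rightarrow> bool" where
  "pos_semidef A \<longleftrightarrow> self_adjoint A \<and> (\<forall>x. 0 \<le> Re (cinner (A x) x))"

definition pos_def :: "('a::chilbert_space \<Rightarrow>\<^sub>L 'a) \<Rightarrow> bool" where
  "pos_def A \<longleftrightarrow> pos_semidef A \<and> invertible_op A"

definition loewner_le :: "('a::chilbert_space \<Rightarrow>\<^sub>L 'a) \<Rightarrow> ('a \<Rightarrow>\<^sub>L 'a) \<Rightarrow> bool"
    (infix "\<le>\<^sub>L" 50) where
  "X \<le>\<^sub>L Y \<longleftrightarrow> pos_semidef (Y - X)"

definition op_poly :: "real poly \<Rightarrow> ('a::chilbert_space \<Rightarrow>\<^sub>L 'a) \<Rightarrow> 'a \<Rightarrow>\<^sub>L 'a" where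
  "op_poly q A = (\<Sum>i\<le>degree q. coeff q i *\<^sub>R (((o\<^sub>L) A ^^ i) id_blinfun))"

(* Continuous functional calculus of a self-adjoint operator A, whose spectrum is real and compact:
   f(A) is the norm limit of q_n(A) for every sequence of polynomials q_n converging to f uniformly
   on the spectrum.  Meaningful only for self-adjoint A and f continuous on the spectrum, where such
   sequences exist (Weierstrass) and the limit does not depend on the sequence. *)
definition fun_calc :: "(real \<Rightarrow> real) \<Rightarrow> ('a::chilbert_space \<Rightarrow>\<^sub>L 'a) \<Rightarrow> 'a \<Rightarrow>\<^sub>L 'a" where
  "fun_calc f A = (THE T. \<forall>q :: nat \<Rightarrow> real poly.
     uniform_limit {x. complex_of_real x \<in> spectrum A} (\<lambda>n. poly (q n)) f sequentially
       \<longrightarrow> (\<lambda>n. op_poly (q n) A) \<longlonglongrightarrow> T)"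

(* For positive definite A the spectrum lies in the open half-line of positive reals, where powr
   is continuous. *)
definition op_powr :: "('a::chilbert_space \<Rightarrow>\<^sub>L 'a) \<Rightarrow> real \<Rightarrow> 'a \<Rightarrow>\<^sub>L 'a" where
  "op_powr A r = fun_calc (\<lambda>x. x powr r) A"

definition geo_mean :: "('a::chilbert_space \<Rightarrow>\<^sub>L 'a) \<Rightarrow> ('a \<Rightarrow>\<^sub>L 'a) \<Rightarrow> 'a \<Rightarrow>\<^sub>L 'a" where
  "geo_mean A B =
     op_powr A (1/2) o\<^sub>L
     op_powr (op_powr A (- 1/2) o\<^sub>L B o\<^sub>L op_powr A (- 1/2)) (1/2) o\<^sub>L
     op_powr A (1/2)"

definition spectral_geo_mean ::
    "real \<Rightarrow> ('a::chilbert_space \<Rightarrow>\<^sub>L 'a) \<Rightarrow> ('a \<Rightarrow>\<^sub>L 'a) \<Rightarrow> 'a \<Rightarrow>\<^sub>L 'a" where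
  "spectral_geo_mean t A B =
     op_powr (geo_mean (op_inv A) B) t o\<^sub>L A o\<^sub>L op_powr (geo_mean (op_inv A) B) t"

end

theory Submission
  imports Defs "HOL-Computational_Algebra.Fundamental_Theorem_Algebra"
begin

text \<open>Put \<open>G = A # B\<close>. The hypothesis says \<open>D P D \<le> P\<close> for \<open>D = G\<^sup>t\<close> and \<open>P = A\<inverse>\<close>. Iterating,
  the powers of \<open>D\<close> are bounded, and as \<open>D\<close> is self-adjoint this forces \<open>D \<le> I\<close>, hence \<open>G \<le> I\<close>.
  What remains is the Ando--Hiai inequality. The implication from \<open>S P S \<le> P\<close> to \<open>S \<le> I\<close> also gives
  the midpoint step of the Loewner--Heinz inequality and the comparison \<open>H \<le> G\<close> from
  \<open>H P H \<le> G P G\<close>, which replaces the monotonicity of the geometric mean.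

  The functional calculus rests on the bound of \<open>q(A)\<close> by the supremum of \<open>q\<close> on the real
  spectrum of a self-adjoint \<open>A\<close>: with \<open>N\<close> the norm of \<open>q(A)\<close>, the operator \<open>q(A)\<^sup>2 - N\<^sup>2\<close>
  is not invertible, so some linear factor of \<open>q\<^sup>2 - N\<^sup>2\<close> is not invertible at \<open>A\<close>.\<close>

subsection \<open>Bounded operators and invertibility\<close>

lemma blinfun_compose_assoc: "(f o\<^sub>L g) o\<^sub>L h = f o\<^sub>L (g o\<^sub>L h)"
  by (rule blinfun_eqI) simp

lemma id_blinfun_compose [simp]: "id_blinfun o\<^sub>L f = f" "f o\<^sub>L id_blinfun = f"
  by (auto intro: blinfun_eqI)

lemmas blinfun_compose_simps =
  bounded_bilinear.add_left[OF bounded_bilinear_blinfun_compose]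
  bounded_bilinear.add_right[OF bounded_bilinear_blinfun_compose]
  bounded_bilinear.diff_left[OF bounded_bilinear_blinfun_compose]
  bounded_bilinear.diff_right[OF bounded_bilinear_blinfun_compose]
  bounded_bilinear.scaleR_left[OF bounded_bilinear_blinfun_compose]
  bounded_bilinear.scaleR_right[OF bounded_bilinear_blinfun_compose]
  bounded_bilinear.sum_left[OF bounded_bilinear_blinfun_compose]
  bounded_bilinear.sum_right[OF bounded_bilinear_blinfun_compose]
  bounded_bilinear.zero_left[OF bounded_bilinear_blinfun_compose]
  bounded_bilinear.zero_right[OF bounded_bilinear_blinfun_compose]

lemma scaleC_scaleR: "c *\<^sub>C (r *\<^sub>R x) = r *\<^sub>R (c *\<^sub>C (x :: 'a::complex_inner))"
  by (simp add: scaleR_scaleC scaleC_scaleC mult.commute)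

lemma bounded_opsI:
  fixes A :: "'a::chilbert_space \<Rightarrow>\<^sub>L 'a"
  shows "(\<And>c x. A (c *\<^sub>C x) = c *\<^sub>C A x) \<Longrightarrow> A \<in> bounded_ops"
  by (simp add: bounded_ops_def)

lemma bounded_opsD: "A \<in> bounded_ops \<Longrightarrow> A (c *\<^sub>C x) = c *\<^sub>C A x"
  by (simp add: bounded_ops_def)

lemma scaleC_diff_right: "c *\<^sub>C (x - y) = c *\<^sub>C x - c *\<^sub>C (y :: 'a::complex_inner)"
  by (metis add_diff_cancel_right' diff_add_cancel scaleC_add_right)

lemma bounded_ops_id [simp]: "id_blinfun \<in> bounded_ops"
  by (rule bounded_opsI) simp

lemma bounded_ops_compose [intro]: "A \<in> bounded_ops \<Longrightarrow> B \<in> bounded_ops \<Longrightarrow> A o\<^sub>L B \<in> bounded_ops"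
  by (rule bounded_opsI) (simp add: bounded_opsD)

lemma bounded_ops_add [intro]: "A \<in> bounded_ops \<Longrightarrow> B \<in> bounded_ops \<Longrightarrow> A + B \<in> bounded_ops"
  by (rule bounded_opsI) (simp add: bounded_opsD blinfun.bilinear_simps scaleC_add_right)

lemma bounded_ops_diff [intro]: "A \<in> bounded_ops \<Longrightarrow> B \<in> bounded_ops \<Longrightarrow> A - B \<in> bounded_ops"
  by (rule bounded_opsI) (simp add: bounded_opsD blinfun.bilinear_simps scaleC_diff_right)

lemma bounded_ops_scaleR [intro]: "A \<in> bounded_ops \<Longrightarrow> r *\<^sub>R A \<in> bounded_ops"
  by (rule bounded_opsI) (simp add: bounded_opsD blinfun.bilinear_simps scaleC_scaleR)

lemma bounded_ops_limit:
  assumes "F \<longlonglongrightarrow> A" and "\<And>n. F n \<in> bounded_ops"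
  shows "A \<in> bounded_ops"
proof (rule bounded_opsI)
  fix c x
  have "(\<lambda>n. F n y) \<longlonglongrightarrow> A y" for y
    by (intro tendsto_intros assms)
  note lim = this
  have "(\<lambda>n. F n (c *\<^sub>C x)) \<longlonglongrightarrow> c *\<^sub>C A x"
    using bounded_linear.tendsto[OF bounded_linear_scaleC lim] by (simp add: bounded_opsD assms(2))
  with lim show "A (c *\<^sub>C x) = c *\<^sub>C A x"
    by (rule LIMSEQ_unique)
qed

lemma self_adjoint_iff:
  "self_adjoint A \<longleftrightarrow> A \<in> bounded_ops \<and> (\<forall>x y. inner (A x) y = inner x (A y))"
proof (intro iffI conjI allI)
  assume A: "A \<in> bounded_ops \<and> (\<forall>x y. inner (A x) y = inner x (A y))"
  have Im: "Im (cinner u v) = inner ((- \<i>) *\<^sub>C u) v" for u v :: 'a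
    by (simp add: inner_cinner cinner_scaleC_left)
  have "cinner (A x) y = cinner x (A y)" for x y
    using A by (simp add: complex_eq_iff Im flip: inner_cinner bounded_opsD[of A])
  then show "self_adjoint A"
    using A by (simp add: self_adjoint_def)
qed (auto simp: self_adjoint_def inner_cinner)

lemma self_adjoint_inner: "self_adjoint A \<Longrightarrow> inner (A x) y = inner x (A y)"
  by (simp add: self_adjoint_iff)

lemma self_adjoint_bounded_ops: "self_adjoint A \<Longrightarrow> A \<in> bounded_ops"
  by (simp add: self_adjoint_def)

lemma self_adjoint_id [simp]: "self_adjoint id_blinfun"
  by (simp add: self_adjoint_iff)

lemma self_adjoint_add [intro]: "self_adjoint A \<Longrightarrow> self_adjoint B \<Longrightarrow> self_adjoint (A + B)"
  by (auto simp: self_adjoint_iff blinfun.bilinear_simps inner_simps)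

lemma self_adjoint_diff [intro]: "self_adjoint A \<Longrightarrow> self_adjoint B \<Longrightarrow> self_adjoint (A - B)"
  by (auto simp: self_adjoint_iff blinfun.bilinear_simps inner_simps)

lemma self_adjoint_scaleR [intro]: "self_adjoint A \<Longrightarrow> self_adjoint (r *\<^sub>R A)"
  by (auto simp: self_adjoint_iff blinfun.bilinear_simps inner_simps)

lemma self_adjoint_zero [simp]: "self_adjoint 0"
  using self_adjoint_scaleR[OF self_adjoint_id, of 0] by simp

lemma self_adjoint_compose:
  assumes "self_adjoint A" "self_adjoint B" "A o\<^sub>L B = B o\<^sub>L A"
  shows "self_adjoint (A o\<^sub>L B)"
proof -
  have "inner ((A o\<^sub>L B) x) y = inner x ((B o\<^sub>L A) y)" for x y
    using assms(1,2) by (simp add: self_adjoint_inner)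
  then show ?thesis
    using assms by (auto simp: self_adjoint_iff)
qed

lemma self_adjoint_conj:
  assumes "self_adjoint Z" "self_adjoint A"
  shows "self_adjoint (Z o\<^sub>L A o\<^sub>L Z)"
  using assms by (auto simp: self_adjoint_iff)

lemma self_adjoint_limit:
  assumes F: "F \<longlonglongrightarrow> A" and sa: "\<And>n. self_adjoint (F n)"
  shows "self_adjoint A"
  unfolding self_adjoint_iff
proof (intro conjI allI)
  show "A \<in> bounded_ops"
    using bounded_ops_limit[OF F] sa by (simp add: self_adjoint_iff)
  fix x y
  have lim: "(\<lambda>n. F n z) \<longlonglongrightarrow> A z" for z
    by (intro tendsto_intros F)
  have "(\<lambda>n. inner (F n x) y) \<longlonglongrightarrow> inner (A x) y" "(\<lambda>n. inner x (F n y)) \<longlonglongrightarrow> inner x (A y)"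
    by (intro tendsto_intros lim)+
  then show "inner (A x) y = inner x (A y)"
    using sa by (simp add: self_adjoint_inner LIMSEQ_unique)
qed

lemma pos_semidef_iff: "pos_semidef A \<longleftrightarrow> self_adjoint A \<and> (\<forall>x. 0 \<le> inner (A x) x)"
  by (simp add: pos_semidef_def inner_cinner)

lemma loewner_leI:
  assumes "self_adjoint X" "self_adjoint Y" "\<And>x. inner (X x) x \<le> inner (Y x) x"
  shows "X \<le>\<^sub>L Y"
  using assms by (auto simp: loewner_le_def pos_semidef_iff blinfun.bilinear_simps inner_simps)

lemma loewner_leD: "X \<le>\<^sub>L Y \<Longrightarrow> inner (X x) x \<le> inner (Y x) x"
  by (auto simp: loewner_le_def pos_semidef_iff blinfun.bilinear_simps inner_simps)

lemma loewner_le_trans [trans]: "X \<le>\<^sub>L Y \<Longrightarrow> Y \<le>\<^sub>L Z \<Longrightarrow> X \<le>\<^sub>L Z"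
proof -
  assume 1: "X \<le>\<^sub>L Y" "Y \<le>\<^sub>L Z"
  have "Z - X = (Z - Y) + (Y - X)" by simp
  then have "self_adjoint (Z - X)"
    using 1 by (metis loewner_le_def pos_semidef_def self_adjoint_add)
  then show ?thesis
    using loewner_leD[OF 1(1)] loewner_leD[OF 1(2)]
    by (auto simp: loewner_le_def pos_semidef_iff blinfun.bilinear_simps inner_simps
        intro: order_trans)
qed

lemma loewner_le_refl [simp]: "X \<le>\<^sub>L X"
  by (simp add: loewner_le_def pos_semidef_iff)

lemma loewner_le_conj:
  assumes "X \<le>\<^sub>L Y" "self_adjoint Z"
  shows "Z o\<^sub>L X o\<^sub>L Z \<le>\<^sub>L Z o\<^sub>L Y o\<^sub>L Z"
proof -
  have "(Z o\<^sub>L Y o\<^sub>L Z) - (Z o\<^sub>L X o\<^sub>L Z) = Z o\<^sub>L (Y - X) o\<^sub>L Z"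
    by (simp add: blinfun_compose_simps)
  then show ?thesis
    using assms self_adjoint_conj[of Z "Y - X"]
    by (simp add: loewner_le_def pos_semidef_iff self_adjoint_inner[of Z])
qed

lemma is_inverse_unique: "is_inverse A C \<Longrightarrow> is_inverse A D \<Longrightarrow> C = D"
  unfolding is_inverse_def by (metis blinfun_compose_assoc id_blinfun_compose)

lemma op_inv_eqI: "is_inverse A C \<Longrightarrow> op_inv A = C"
  unfolding op_inv_def by (rule the_equality) (auto intro: is_inverse_unique)

lemma invertible_op_compose:
  assumes "invertible_op A" "invertible_op B"
  shows "invertible_op (A o\<^sub>L B)"
proof -
  obtain C D where CD: "is_inverse A C" "is_inverse B D"
    using assms unfolding invertible_op_def by blast
  have "A o\<^sub>L B o\<^sub>L (D o\<^sub>L C) = A o\<^sub>L (B o\<^sub>L D) o\<^sub>L C" "D o\<^sub>L C o\<^sub>L (A o\<^sub>L B) = D o\<^sub>L (C o\<^sub>L A) o\<^sub>L B"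
    by (simp_all add: blinfun_compose_assoc)
  with CD have "is_inverse (A o\<^sub>L B) (D o\<^sub>L C)"
    by (auto simp: is_inverse_def)
  then show ?thesis
    unfolding invertible_op_def by blast
qed

lemma invertible_op_scaleR:
  assumes "invertible_op A" "r \<noteq> 0"
  shows "invertible_op (r *\<^sub>R A)"
proof -
  obtain C where "is_inverse A C"
    using assms unfolding invertible_op_def by blast
  then have "is_inverse (r *\<^sub>R A) ((1 / r) *\<^sub>R C)"
    using assms(2) by (auto simp: is_inverse_def blinfun_compose_simps)
  then show ?thesis
    unfolding invertible_op_def by blast
qed

lemma invertible_op_id [simp]: "invertible_op id_blinfun"
  unfolding invertible_op_def is_inverse_def by (auto intro: exI[of _ id_blinfun])

text \<open>Lax--Milgram: a coercive operator \<open>T\<close> is onto because \<open>x - \<epsilon> (T x - y)\<close> is a contraction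
  in \<open>x\<close> for small \<open>\<epsilon>\<close>.\<close>

lemma invertible_op_coercive:
  fixes T :: "'a::chilbert_space \<Rightarrow>\<^sub>L 'a"
  assumes T: "T \<in> bounded_ops" and c: "c > 0" and coercive: "\<And>x. c * inner x x \<le> inner (T x) x"
  shows "invertible_op T"
proof -
  define M where "M = norm T + c"
  have M: "M > 0" "c \<le> M" "norm T \<le> M"
    using c by (auto simp: M_def add_nonneg_pos)
  define e where "e = c / M\<^sup>2"
  have e: "e > 0"
    using c M by (simp add: e_def)
  have q: "0 \<le> 1 - c\<^sup>2 / M\<^sup>2" "1 - c\<^sup>2 / M\<^sup>2 < 1"
    using c M by (auto simp: power_mono)
  have contr: "norm (x - e *\<^sub>R T x) \<le> sqrt (1 - c\<^sup>2 / M\<^sup>2) * norm x" for x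
  proof (rule power2_le_imp_le)
    have "norm (T x) \<le> M * norm x"
      by (rule order_trans[OF norm_blinfun]) (intro mult_right_mono M norm_ge_zero)
    then have "(norm (T x))\<^sup>2 \<le> M\<^sup>2 * inner x x"
      by (metis norm_ge_zero power2_norm_eq_inner power_mono power_mult_distrib)
    then have TT: "e\<^sup>2 * inner (T x) (T x) \<le> e\<^sup>2 * (M\<^sup>2 * inner x x)"
      by (intro mult_left_mono) (auto simp: power2_norm_eq_inner)
    have "(norm (x - e *\<^sub>R T x))\<^sup>2 = inner x x - 2 * e * inner (T x) x + e\<^sup>2 * inner (T x) (T x)"
      unfolding power2_norm_eq_inner by (simp add: inner_simps inner_commute power2_eq_square)
    also have "\<dots> \<le> inner x x - 2 * e * (c * inner x x) + e\<^sup>2 * (M\<^sup>2 * inner x x)"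
      using e by (intro add_mono diff_mono TT mult_left_mono coercive) auto
    also have "\<dots> = (1 - c\<^sup>2 / M\<^sup>2) * inner x x"
      using M by (simp add: e_def field_simps power2_eq_square)
    finally show "(norm (x - e *\<^sub>R T x))\<^sup>2 \<le> (sqrt (1 - c\<^sup>2 / M\<^sup>2) * norm x)\<^sup>2"
      using q by (simp add: power_mult_distrib power2_norm_eq_inner)
  qed (use q in auto)
  have "\<exists>x. T x = y" for y
  proof -
    have "\<exists>!x. x - e *\<^sub>R (T x - y) = x"
    proof (rule banach_fix_type)
      show "0 \<le> sqrt (1 - c\<^sup>2 / M\<^sup>2)" "sqrt (1 - c\<^sup>2 / M\<^sup>2) < 1"
        using q c M by (auto simp: power_mono)
      have "x - e *\<^sub>R (T x - y) - (z - e *\<^sub>R (T z - y)) = (x - z) - e *\<^sub>R T (x - z)" for x z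
        by (simp add: blinfun.bilinear_simps algebra_simps)
      note d = this
      show "\<forall>x z. dist (x - e *\<^sub>R (T x - y)) (z - e *\<^sub>R (T z - y)) \<le> sqrt (1 - c\<^sup>2 / M\<^sup>2) * dist x z"
        unfolding dist_norm d by (blast intro: contr)
    qed
    then show ?thesis
      using e by auto
  qed
  then obtain g where g: "\<And>y. T (g y) = y"
    by metis
  have below: "c * norm x \<le> norm (T x)" for x
  proof (cases "x = 0")
    case False
    have "c * norm x * norm x \<le> norm (T x) * norm x"
      using coercive[of x] norm_cauchy_schwarz[of "T x" x]
      by (simp add: mult.assoc norm_eq_sqrt_inner)
    then show ?thesis
      using False by simp
  qed simp
  have inj: "x = y" if "T x = T y" for x y
    using below[of "x - y"] that c by (simp add: blinfun.bilinear_simps mult_le_0_iff)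
  have gT: "g (T x) = x" for x
    by (rule inj) (simp add: g)
  have "bounded_linear g"
  proof (rule bounded_linear_intro)
    show "g (x + y) = g x + g y" "g (r *\<^sub>R x) = r *\<^sub>R g x" for x y r
      by (rule inj, simp add: g blinfun.bilinear_simps)+
    show "norm (g x) \<le> norm x * (1 / c)" for x
      using below[of "g x"] c by (simp add: g field_simps)
  qed
  then have app: "Blinfun g x = g x" for x
    by (simp add: bounded_linear_Blinfun_apply)
  have "g (a *\<^sub>C x) = a *\<^sub>C g x" for a x
    by (rule inj) (simp add: g bounded_opsD[OF T])
  then have "is_inverse T (Blinfun g)"
    unfolding is_inverse_def by (auto intro!: bounded_opsI blinfun_eqI simp: app g gT)
  then show ?thesis
    unfolding invertible_op_def by blast
qed

lemma inner_le_norm_blinfun: "inner (blinfun_apply A x) x \<le> norm A * inner x x"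
proof -
  have "inner (A x) x \<le> norm (A x) * norm x"
    by (rule norm_cauchy_schwarz)
  also have "\<dots> \<le> (norm A * norm x) * norm x"
    by (intro mult_right_mono norm_blinfun norm_ge_zero)
  also have "\<dots> = norm A * inner x x"
    by (simp add: power2_eq_square flip: power2_norm_eq_inner)
  finally show ?thesis .
qed

lemma pos_semidef_invertible_coercive:
  fixes N :: "'a::chilbert_space \<Rightarrow>\<^sub>L 'a"
  assumes N: "pos_semidef N" "invertible_op N"
  obtains c where "c > 0" "\<And>x. c * inner x x \<le> inner (N x) x"
proof -
  obtain C where C: "is_inverse N C"
    using N unfolding invertible_op_def by blast
  define K where "K = norm N + 1"
  define L where "L = norm C + 1"
  have K: "K > 0" "L > 0"
    by (simp_all add: K_def L_def add_nonneg_pos)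
  have sa: "inner (N x) y = inner x (N y)" for x y
    using N by (simp add: pos_semidef_iff self_adjoint_inner)
  have NK: "inner (N x) x \<le> K * inner x x" for x
    by (rule order_trans[OF inner_le_norm_blinfun]) (auto simp: K_def intro: mult_right_mono)
  have 1: "inner (N x) (N x) \<le> K * inner (N x) x" for x
  proof -
    have "0 \<le> inner (N (x - (1/K) *\<^sub>R N x)) (x - (1/K) *\<^sub>R N x)"
      using N by (simp add: pos_semidef_iff)
    also have "\<dots> = inner (N x) x - 2 / K * inner (N x) (N x) + (1/K)\<^sup>2 * inner (N (N x)) (N x)"
      by (simp add: blinfun.bilinear_simps inner_simps sa power2_eq_square algebra_simps)
    also have "\<dots> \<le> inner (N x) x - 2 / K * inner (N x) (N x) + (1/K)\<^sup>2 * (K * inner (N x) (N x))"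
      using NK[of "N x"] by (simp add: divide_right_mono power_divide)
    also have "\<dots> = inner (N x) x - inner (N x) (N x) / K"
      using K by (simp add: field_simps power2_eq_square)
    finally show ?thesis
      using K by (simp add: field_simps)
  qed
  have 2: "inner x x \<le> L\<^sup>2 * inner (N x) (N x)" for x
  proof -
    have "C (N x) = x"
      using C by (metis blinfun_apply_blinfun_compose blinfun_apply_id_blinfun is_inverse_def)
    then have "norm x \<le> norm C * norm (N x)"
      using norm_blinfun[of C "N x"] by simp
    also have "\<dots> \<le> L * norm (N x)"
      by (intro mult_right_mono) (auto simp: L_def)
    finally have "(norm x)\<^sup>2 \<le> (L * norm (N x))\<^sup>2"
      by (rule power_mono) simp
    then show ?thesis
      by (simp add: power_mult_distrib power2_norm_eq_inner)
  qed
  show ?thesis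
  proof (rule that)
    show "1 / (L\<^sup>2 * K) > 0"
      using K by simp
    fix x
    have "inner x x \<le> L\<^sup>2 * (K * inner (N x) x)"
      using 2[of x] mult_left_mono[OF 1[of x], of "L\<^sup>2"] by simp
    then show "1 / (L\<^sup>2 * K) * inner x x \<le> inner (N x) x"
      using K by (simp add: field_simps)
  qed
qed

lemma not_invertible_norm:
  fixes T :: "'a::chilbert_space \<Rightarrow>\<^sub>L 'a"
  assumes T: "self_adjoint T" and x: "(x::'a) \<noteq> 0"
  shows "\<not> invertible_op ((T o\<^sub>L T) - (norm T)\<^sup>2 *\<^sub>R id_blinfun)"
proof
  assume "invertible_op ((T o\<^sub>L T) - (norm T)\<^sup>2 *\<^sub>R id_blinfun)"
  then have inv: "invertible_op ((norm T)\<^sup>2 *\<^sub>R id_blinfun - (T o\<^sub>L T))"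
    using invertible_op_scaleR[of _ "-1"] by fastforce
  have eq: "inner (((norm T)\<^sup>2 *\<^sub>R id_blinfun - (T o\<^sub>L T)) x) x = (norm T * norm x)\<^sup>2 - (norm (T x))\<^sup>2" for x
    using T by (simp add: blinfun.bilinear_simps inner_simps power2_norm_eq_inner power_mult_distrib self_adjoint_inner)
  have "pos_semidef ((norm T)\<^sup>2 *\<^sub>R id_blinfun - (T o\<^sub>L T))"
    unfolding pos_semidef_iff eq
    using self_adjoint_compose[OF T T refl] by (auto intro!: self_adjoint_diff power_mono norm_blinfun)
  then obtain c where c: "c > 0" "\<And>x. c * inner x x \<le> (norm T * norm x)\<^sup>2 - (norm (T x))\<^sup>2"
    using pos_semidef_invertible_coercive[OF _ inv] unfolding eq by metis
  have le: "(norm (T y))\<^sup>2 \<le> ((norm T)\<^sup>2 - c) * (norm y)\<^sup>2" for y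
    using c(2)[of y] by (simp add: power2_norm_eq_inner power_mult_distrib algebra_simps)
  have "0 \<le> ((norm T)\<^sup>2 - c) * (norm x)\<^sup>2"
    using le[of x] by (rule order_trans[OF zero_le_power2])
  then have nn: "0 \<le> (norm T)\<^sup>2 - c"
    using x by (simp add: zero_le_mult_iff)
  have "norm T \<le> sqrt ((norm T)\<^sup>2 - c)"
  proof (rule norm_blinfun_bound)
    fix y
    show "norm (T y) \<le> sqrt ((norm T)\<^sup>2 - c) * norm y"
      by (rule power2_le_imp_le) (use le[of y] nn in \<open>auto simp: power_mult_distrib\<close>)
  qed (use nn in simp)
  then have "(norm T)\<^sup>2 \<le> (norm T)\<^sup>2 - c"
    using nn real_le_rsqrt by (metis norm_ge_zero power_mono real_sqrt_pow2)
  with c(1) show False by simp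
qed

subsection \<open>Functional calculus\<close>

lemma op_poly_eq_sum:
  assumes "degree q \<le> n"
  shows "op_poly q A = (\<Sum>i\<le>n. coeff q i *\<^sub>R (((o\<^sub>L) A ^^ i) id_blinfun))"
  unfolding op_poly_def
  using assms by (intro sum.mono_neutral_left) (auto simp: coeff_eq_0)

lemma op_poly_0 [simp]: "op_poly 0 A = 0"
  by (simp add: op_poly_def)

lemma op_poly_pCons [simp]: "op_poly (pCons a q) A = a *\<^sub>R id_blinfun + (A o\<^sub>L op_poly q A)"
proof -
  have "op_poly (pCons a q) A = (\<Sum>i\<le>Suc (degree q). coeff (pCons a q) i *\<^sub>R (((o\<^sub>L) A ^^ i) id_blinfun))"
    by (intro op_poly_eq_sum degree_pCons_le)
  also have "\<dots> = a *\<^sub>R id_blinfun + (\<Sum>i\<le>degree q. coeff q i *\<^sub>R (A o\<^sub>L ((o\<^sub>L) A ^^ i) id_blinfun))"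
    by (subst sum.atMost_Suc_shift) simp
  also have "(\<Sum>i\<le>degree q. coeff q i *\<^sub>R (A o\<^sub>L ((o\<^sub>L) A ^^ i) id_blinfun)) = A o\<^sub>L op_poly q A"
    by (simp add: op_poly_def blinfun_compose_simps)
  finally show ?thesis .
qed

lemma op_poly_add: "op_poly (p + q) A = op_poly p A + op_poly q A"
proof (induction p q rule: poly_induct2)
  case (pCons a p b q)
  then show ?case by (simp add: blinfun_compose_simps scaleR_add_left)
qed simp

lemma op_poly_smult: "op_poly (smult c p) A = c *\<^sub>R op_poly p A"
  by (induction p) (simp_all add: blinfun_compose_simps scaleR_add_right)

lemma op_poly_diff: "op_poly (p - q) A = op_poly p A - op_poly q A"
  using op_poly_add[of p "smult (-1) q" A] unfolding op_poly_smult by simp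

lemma op_poly_mult: "op_poly (p * q) A = op_poly p A o\<^sub>L op_poly q A"
  by (induction p) (simp_all add: op_poly_add op_poly_smult blinfun_compose_simps blinfun_compose_assoc)

lemma op_poly_intertwine:
  assumes "Z o\<^sub>L A = S o\<^sub>L Z"
  shows "Z o\<^sub>L op_poly q A = op_poly q S o\<^sub>L Z"
proof (induction q)
  case (pCons a q)
  then show ?case
    using assms by (simp add: blinfun_compose_simps) (metis blinfun_compose_assoc)
qed simp

lemma self_adjoint_op_poly: "self_adjoint A \<Longrightarrow> self_adjoint (op_poly q A)"
proof (induction q)
  case (pCons a q)
  then show ?case
    using op_poly_intertwine[of A A A q] by (auto intro!: self_adjoint_add self_adjoint_compose)
qed simp

lemma op_poly_const: "op_poly [:c:] A = c *\<^sub>R id_blinfun"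
  by simp

lemma op_poly_linear: "op_poly [:- c, 1:] A = A - c *\<^sub>R id_blinfun"
  by simp

lemma poly_of_real_of_real:
  "poly (map_poly complex_of_real p) (of_real x) = of_real (poly p x)"
  by (induction p) (simp_all add: map_poly_pCons)

lemma poly_of_real_add:
  "poly (map_poly complex_of_real (p + q)) z = poly (map_poly complex_of_real p) z + poly (map_poly complex_of_real q) z"
  by (induction p q rule: poly_induct2) (simp_all add: map_poly_pCons algebra_simps)

lemma poly_of_real_smult:
  "poly (map_poly complex_of_real (smult c p)) z = of_real c * poly (map_poly complex_of_real p) z"
  by (induction p) (simp_all add: map_poly_pCons algebra_simps)

lemma poly_of_real_mult:
  "poly (map_poly complex_of_real (p * q)) z = poly (map_poly complex_of_real p) z * poly (map_poly complex_of_real q) z"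
  by (induction p) (simp_all add: map_poly_pCons poly_of_real_add poly_of_real_smult algebra_simps)

text \<open>A non-real root \<open>a + b \<i>\<close> of \<open>p\<close> contributes the real factor \<open>(x - a)\<^sup>2 + b\<^sup>2\<close>, which is
  coercive on self-adjoint operators; hence only real roots can obstruct invertibility.\<close>

lemma invertible_op_poly:
  fixes A :: "'a::chilbert_space \<Rightarrow>\<^sub>L 'a"
  assumes A: "self_adjoint A"
  shows "p \<noteq> 0 \<Longrightarrow> (\<And>x. poly p x = 0 \<Longrightarrow> invertible_op (A - x *\<^sub>R id_blinfun)) \<Longrightarrow> invertible_op (op_poly p A)"
proof (induction "degree p" arbitrary: p rule: less_induct)
  case less
  have step: "invertible_op (op_poly p A)"
    if p: "p = f * g" and f: "invertible_op (op_poly f A)" "degree f > 0" for f g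
  proof -
    have "degree g < degree p" "g \<noteq> 0"
      using f less.prems(1) unfolding p by (auto simp: degree_mult_eq)
    then have "invertible_op (op_poly g A)"
      using less unfolding p by simp
    with f show ?thesis
      by (simp add: p op_poly_mult invertible_op_compose)
  qed
  let ?p = "map_poly complex_of_real p"
  show ?case
  proof (cases "degree p = 0")
    case True
    then obtain c where "p = [:c:]" "c \<noteq> 0"
      using less.prems(1) by (metis degree_eq_zeroE pCons_0_0)
    then show ?thesis
      using op_poly_const[of c A] by (auto intro: invertible_op_scaleR)
  next
    case False
    then have "\<not> constant (poly ?p)"
      by (simp add: constant_degree degree_map_poly)
    then obtain z where z: "poly ?p z = 0"
      using fundamental_theorem_of_algebra by blast
    define a b where "a = Re z" and "b = Im z"
    show ?thesis
    proof (cases "b = 0")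
      case True
      then have "z = of_real a"
        by (simp add: a_def b_def complex_eq_iff)
      then have a: "poly p a = 0"
        using z by (simp add: poly_of_real_of_real)
      then obtain g where "p = [:- a, 1:] * g"
        by (auto simp: poly_eq_0_iff_dvd)
      moreover have "invertible_op (op_poly [:- a, 1:] A)"
        using less.prems(2)[OF a] by simp
      ultimately show ?thesis
        by (rule step) simp
    next
      case False
      define d where "d = [:- a, 1:] * [:- a, 1:] + [:b\<^sup>2:]"
      have d: "d = [:a\<^sup>2 + b\<^sup>2, - 2 * a, 1:]"
        by (simp add: d_def power2_eq_square)
      then have deg: "degree d = 2"
        by simp
      have dz: "poly (map_poly complex_of_real d) z = 0"
        by (simp add: d a_def b_def complex_eq_iff power2_eq_square map_poly_pCons algebra_simps)
      define r where "r = p mod d"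
      obtain k where p: "p = d * k + r"
        unfolding r_def by (metis mult_div_mod_eq)
      have "degree r < 2"
        using degree_mod_less[of d p] deg unfolding r_def by fastforce
      then have "r = [:coeff r 0, coeff r 1:]"
        by (intro poly_eqI) (auto simp: coeff_pCons coeff_eq_0 split: nat.split)
      then obtain r0 r1 where r: "r = [:r0, r1:]"
        by blast
      have "poly ?p z = poly (map_poly complex_of_real d) z * poly (map_poly complex_of_real k) z
          + poly (map_poly complex_of_real r) z"
        by (simp add: p poly_of_real_add poly_of_real_mult)
      then have "r0 + r1 * a = 0" "r1 * b = 0"
        using z dz by (simp_all add: r map_poly_pCons complex_eq_iff a_def b_def mult.commute)
      then have "r = 0"
        using False by (simp add: r)
      then have "p = d * k"
        using p by simp
      moreover have "invertible_op (op_poly d A)"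
      proof (rule invertible_op_coercive)
        show "op_poly d A \<in> bounded_ops"
          using self_adjoint_op_poly[OF A] by (simp add: self_adjoint_bounded_ops)
        show "b\<^sup>2 > 0"
          using False by simp
        fix x
        let ?S = "A - a *\<^sub>R id_blinfun"
        have "self_adjoint ?S"
          by (intro self_adjoint_diff self_adjoint_scaleR A self_adjoint_id)
        then have "inner (op_poly d A x) x = inner (?S x) (?S x) + b\<^sup>2 * inner x x"
          unfolding d_def op_poly_add op_poly_mult op_poly_linear op_poly_const
          by (simp add: plus_blinfun.rep_eq scaleR_blinfun.rep_eq inner_simps self_adjoint_inner[of ?S])
        then show "b\<^sup>2 * inner x x \<le> inner (op_poly d A x) x"
          by simp
      qed
      ultimately show ?thesis
        by (rule step) (simp add: deg)
    qed
  qed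
qed

definition real_spectrum :: "('a::chilbert_space \<Rightarrow>\<^sub>L 'a) \<Rightarrow> real set" where
  "real_spectrum A = {x. complex_of_real x \<in> spectrum A}"

lemma real_spectrum_iff: "x \<in> real_spectrum A \<longleftrightarrow> \<not> invertible_op (A - x *\<^sub>R id_blinfun)"
proof -
  have "scalar_op (complex_of_real x) = x *\<^sub>R (id_blinfun :: 'a \<Rightarrow>\<^sub>L 'a)"
    by (rule blinfun_eqI) (simp add: blinfun.bilinear_simps scaleR_scaleC)
  then show ?thesis
    by (simp add: real_spectrum_def spectrum_def)
qed

lemma norm_op_poly_le_real_spectrum:
  fixes A :: "'a::chilbert_space \<Rightarrow>\<^sub>L 'a"
  assumes A: "self_adjoint A" and e: "e \<ge> 0" and le: "\<And>x. x \<in> real_spectrum A \<Longrightarrow> \<bar>poly q x\<bar> \<le> e"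
  shows "norm (op_poly q A) \<le> e"
proof (cases "\<forall>x::'a. x = 0")
  case True
  have "op_poly q A = 0"
    by (rule blinfun_eqI) (rule trans[OF True[rule_format] True[rule_format, symmetric]])
  with e show ?thesis
    by simp
next
  case False
  then obtain u :: 'a where u: "u \<noteq> 0"
    by blast
  have root: "\<exists>x \<in> real_spectrum A. poly p x = 0" if "\<not> invertible_op (op_poly p A)" "p \<noteq> 0" for p
  proof (rule ccontr)
    assume n: "\<not> ?thesis"
    have "invertible_op (op_poly p A)"
      by (rule invertible_op_poly[OF A that(2)]) (use n real_spectrum_iff in blast)
    with that(1) show False by contradiction
  qed
  have "\<not> invertible_op (op_poly [:- ((norm A)\<^sup>2), 0, 1:] A)"
    using not_invertible_norm[OF A u] by (simp add: scaleR_minus_left)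
  moreover have "[:- ((norm A)\<^sup>2), 0, 1:] \<noteq> 0"
    by simp
  ultimately obtain x0 where x0: "x0 \<in> real_spectrum A"
    using root[of "[:- ((norm A)\<^sup>2), 0, 1:]"] by blast
  define N where "N = norm (op_poly q A)"
  define p where "p = q * q - [:N\<^sup>2:]"
  have "op_poly p A = (op_poly q A o\<^sub>L op_poly q A) - N\<^sup>2 *\<^sub>R id_blinfun"
    by (simp only: p_def op_poly_diff op_poly_mult op_poly_const)
  then have "\<not> invertible_op (op_poly p A)"
    using not_invertible_norm[OF self_adjoint_op_poly[OF A] u] by (simp only: N_def not_False_eq_True)
  then obtain x where x: "x \<in> real_spectrum A" "poly p x = 0"
    using root[of p] x0 by (cases "p = 0") auto
  then have "N\<^sup>2 = \<bar>poly q x\<bar>\<^sup>2"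
    by (simp add: p_def power2_eq_square)
  then have "N = \<bar>poly q x\<bar>"
    by (rule power2_eq_imp_eq) (simp_all add: N_def)
  with le[OF x(1)] show ?thesis by (simp add: N_def)
qed

definition op_between :: "real \<Rightarrow> real \<Rightarrow> ('a::chilbert_space \<Rightarrow>\<^sub>L 'a) \<Rightarrow> bool" where
  "op_between m M A \<longleftrightarrow> self_adjoint A \<and> (\<forall>x. m * inner x x \<le> inner (A x) x \<and> inner (A x) x \<le> M * inner x x)"

lemma op_between_mono: "op_between m M A \<Longrightarrow> m' \<le> m \<Longrightarrow> M \<le> M' \<Longrightarrow> op_between m' M' A"
  unfolding op_between_def by (meson inner_ge_zero mult_right_mono order_trans)

lemma real_spectrum_op_between:
  assumes A: "op_between m M A"
  shows "real_spectrum A \<subseteq> {m..M}"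
proof
  fix x assume x: "x \<in> real_spectrum A"
  have A': "self_adjoint A" "m * inner y y \<le> inner (A y) y" "inner (A y) y \<le> M * inner y y" for y
    using A by (auto simp: op_between_def)
  have bd: "A - x *\<^sub>R id_blinfun \<in> bounded_ops"
    using A' by (intro bounded_ops_diff) (auto simp: self_adjoint_bounded_ops)
  have "\<not> x < m"
  proof
    assume "x < m"
    then have "invertible_op (A - x *\<^sub>R id_blinfun)"
      using A'(2) by (intro invertible_op_coercive[OF bd, of "m - x"])
        (auto simp: blinfun.bilinear_simps inner_simps algebra_simps)
    with x show False by (simp add: real_spectrum_iff)
  qed
  moreover have "\<not> x > M"
  proof
    assume "x > M"
    then have "invertible_op ((-1) *\<^sub>R (A - x *\<^sub>R id_blinfun))"
      using A'(3) by (intro invertible_op_coercive[OF bounded_ops_scaleR[OF bd], of "x - M"])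
        (auto simp: blinfun.bilinear_simps inner_simps algebra_simps)
    then have "invertible_op ((-1) *\<^sub>R ((-1) *\<^sub>R (A - x *\<^sub>R id_blinfun)))"
      by (rule invertible_op_scaleR) simp
    then have "invertible_op (A - x *\<^sub>R id_blinfun)"
      by simp
    with x[unfolded real_spectrum_iff] show False by contradiction
  qed
  ultimately show "x \<in> {m..M}" by simp
qed

lemma weierstrass_poly:
  fixes f :: "real \<Rightarrow> real"
  assumes f: "continuous_on {m..M} f"
  obtains q :: "nat \<Rightarrow> real poly" where "uniform_limit {m..M} (\<lambda>n. poly (q n)) f sequentially"
proof -
  have "\<exists>q :: real poly. \<forall>x\<in>{m..M}. \<bar>f x - poly q x\<bar> < inverse (real (Suc n))" for n
  proof -
    obtain g where g: "real_polynomial_function g" "\<And>x. x \<in> {m..M} \<Longrightarrow> \<bar>f x - g x\<bar> < inverse (real (Suc n))"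
      using Stone_Weierstrass_real_polynomial_function[of "{m..M}" f "inverse (real (Suc n))"] f
      by (metis compact_Icc inverse_positive_iff_positive of_nat_0_less_iff zero_less_Suc)
    obtain a k where "g = (\<lambda>x. \<Sum>i\<le>k. a i * x ^ i)"
      using g(1) unfolding real_polynomial_function_iff_sum by blast
    then have "poly (\<Sum>i\<le>k. monom (a i) i) x = g x" for x
      by (simp add: poly_sum poly_monom)
    with g(2) show ?thesis by metis
  qed
  then obtain q :: "nat \<Rightarrow> real poly"
    where q: "\<And>n x. x \<in> {m..M} \<Longrightarrow> \<bar>f x - poly (q n) x\<bar> < inverse (real (Suc n))"
    by metis
  have "uniform_limit {m..M} (\<lambda>n. poly (q n)) f sequentially"
  proof (rule uniform_limitI)
    fix e :: real assume "e > 0"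
    with LIMSEQ_inverse_real_of_nat have "\<forall>\<^sub>F n in sequentially. inverse (real (Suc n)) < e"
      by (rule order_tendstoD)
    then show "\<forall>\<^sub>F n in sequentially. \<forall>x\<in>{m..M}. dist (poly (q n) x) (f x) < e"
    proof eventually_elim
      case (elim n)
      show ?case
      proof
        fix x assume "x \<in> {m..M}"
        from q[OF this, of n] elim show "dist (poly (q n) x) (f x) < e"
          by (simp only: dist_real_def abs_minus_commute)
      qed
    qed
  qed
  then show ?thesis by (rule that)
qed

lemma fun_calc_tendsto_aux:
  fixes A :: "'a::chilbert_space \<Rightarrow>\<^sub>L 'a"
  assumes A: "self_adjoint A"
    and p: "uniform_limit (real_spectrum A) (\<lambda>n. poly (p n)) f sequentially"
    and q: "uniform_limit (real_spectrum A) (\<lambda>n. poly (q n)) f sequentially"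
    and lim: "(\<lambda>n. op_poly (p n) A) \<longlonglongrightarrow> T"
  shows "(\<lambda>n. op_poly (q n) A) \<longlonglongrightarrow> T"
proof -
  have "(\<lambda>n. op_poly (q n - p n) A) \<longlonglongrightarrow> 0"
  proof (rule LIMSEQ_I)
    fix e :: real assume e: "e > 0"
    then have e4: "e/4 > 0" by simp
    from uniform_limitD[OF p e4] uniform_limitD[OF q e4]
    have "\<forall>\<^sub>F n in sequentially. norm (op_poly (q n - p n) A - 0) < e"
    proof eventually_elim
      case (elim n)
      have "norm (op_poly (q n - p n) A) \<le> e/2"
      proof (rule norm_op_poly_le_real_spectrum[OF A])
        fix x assume "x \<in> real_spectrum A"
        with elim have "\<bar>poly (p n) x - f x\<bar> < e/4" "\<bar>poly (q n) x - f x\<bar> < e/4"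
          by (auto simp: dist_real_def)
        then show "\<bar>poly (q n - p n) x\<bar> \<le> e/2"
          by (simp add: abs_if split: if_splits)
      qed (use e in simp)
      with e show ?case by simp
    qed
    then show "\<exists>N. \<forall>n\<ge>N. norm (op_poly (q n - p n) A - 0) < e"
      by (simp add: eventually_sequentially)
  qed
  from tendsto_add[OF this lim] show ?thesis
    by (simp add: op_poly_diff)
qed

lemma fun_calc_tendsto:
  fixes A :: "'a::chilbert_space \<Rightarrow>\<^sub>L 'a"
  assumes A: "op_between m M A" and f: "continuous_on {m..M} f"
    and q: "uniform_limit {m..M} (\<lambda>n. poly (q n)) f sequentially"
  shows "(\<lambda>n. op_poly (q n) A) \<longlonglongrightarrow> fun_calc f A"
proof -
  have sa: "self_adjoint A"
    using A by (simp add: op_between_def)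
  have q': "uniform_limit (real_spectrum A) (\<lambda>n. poly (q n)) f sequentially"
    by (rule uniform_limit_on_subset[OF q real_spectrum_op_between[OF A]])
  have "Cauchy (\<lambda>n. op_poly (q n) A)"
  proof (rule metric_CauchyI)
    fix e :: real assume e: "e > 0"
    obtain N where N: "\<And>n x. n \<ge> N \<Longrightarrow> x \<in> real_spectrum A \<Longrightarrow> \<bar>poly (q n) x - f x\<bar> < e/4"
      using uniform_limitD[OF q', of "e/4"] e by (auto simp: eventually_sequentially dist_real_def)
    have "dist (op_poly (q i) A) (op_poly (q j) A) < e" if "i \<ge> N" "j \<ge> N" for i j
    proof -
      have "norm (op_poly (q i - q j) A) \<le> e/2"
      proof (rule norm_op_poly_le_real_spectrum[OF sa])
        fix x assume "x \<in> real_spectrum A"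
        from N[OF that(1) this] N[OF that(2) this]
        show "\<bar>poly (q i - q j) x\<bar> \<le> e/2"
          by (simp add: abs_if split: if_splits)
      qed (use e in simp)
      with e show ?thesis by (simp add: dist_norm op_poly_diff)
    qed
    then show "\<exists>N. \<forall>i\<ge>N. \<forall>j\<ge>N. dist (op_poly (q i) A) (op_poly (q j) A) < e"
      by blast
  qed
  then obtain T where T: "(\<lambda>n. op_poly (q n) A) \<longlonglongrightarrow> T"
    using Cauchy_convergent convergent_def by blast
  have "fun_calc f A = T"
    unfolding fun_calc_def real_spectrum_def[symmetric]
  proof (rule the_equality)
    show "\<forall>p. uniform_limit (real_spectrum A) (\<lambda>n. poly (p n)) f sequentially \<longrightarrow> (\<lambda>n. op_poly (p n) A) \<longlonglongrightarrow> T"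
      using fun_calc_tendsto_aux[OF sa q' _ T] by blast
    show "T' = T" if "\<forall>p. uniform_limit (real_spectrum A) (\<lambda>n. poly (p n)) f sequentially \<longrightarrow> (\<lambda>n. op_poly (p n) A) \<longlonglongrightarrow> T'" for T'
      using that q' T LIMSEQ_unique by blast
  qed
  with T show ?thesis by simp
qed

lemma op_between_self_adjoint: "op_between m M A \<Longrightarrow> self_adjoint A"
  by (simp add: op_between_def)

lemma self_adjoint_fun_calc:
  assumes A: "op_between m M A" and f: "continuous_on {m..M} f"
  shows "self_adjoint (fun_calc f A)"
proof -
  obtain q where q: "uniform_limit {m..M} (\<lambda>n. poly (q n)) f sequentially"
    using weierstrass_poly[OF f] .
  show ?thesis
    by (rule self_adjoint_limit[OF fun_calc_tendsto[OF A f q] self_adjoint_op_poly[OF op_between_self_adjoint[OF A]]])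
qed

lemma fun_calc_poly:
  assumes A: "op_between m M A" and f: "\<And>x. x \<in> {m..M} \<Longrightarrow> f x = poly q x"
  shows "fun_calc f A = op_poly q A"
proof -
  have "continuous_on {m..M} f"
    by (subst continuous_on_cong[OF refl f]) (auto intro: continuous_intros)
  moreover have "uniform_limit {m..M} (\<lambda>n. poly q) f sequentially"
    by (rule uniform_limitI) (simp add: f)
  ultimately have "(\<lambda>n::nat. op_poly q A) \<longlonglongrightarrow> fun_calc f A"
    by (rule fun_calc_tendsto[OF A])
  then show ?thesis
    by (simp add: LIMSEQ_const_iff)
qed

lemma fun_calc_diff:
  assumes A: "op_between m M A" and f: "continuous_on {m..M} f" and g: "continuous_on {m..M} g"
  shows "fun_calc (\<lambda>x. f x - g x) A = fun_calc f A - fun_calc g A"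
proof -
  obtain p where p: "uniform_limit {m..M} (\<lambda>n. poly (p n)) f sequentially"
    using weierstrass_poly[OF f] .
  obtain q where q: "uniform_limit {m..M} (\<lambda>n. poly (q n)) g sequentially"
    using weierstrass_poly[OF g] .
  have "uniform_limit {m..M} (\<lambda>n. poly (p n - q n)) (\<lambda>x. f x - g x) sequentially"
    unfolding poly_diff[abs_def] by (rule uniform_limit_minus[OF p q])
  then have "(\<lambda>n. op_poly (p n - q n) A) \<longlonglongrightarrow> fun_calc (\<lambda>x. f x - g x) A"
    by (intro fun_calc_tendsto[OF A]) (intro continuous_intros f g)
  moreover have "(\<lambda>n. op_poly (p n - q n) A) \<longlonglongrightarrow> fun_calc f A - fun_calc g A"
    unfolding op_poly_diff
    by (intro tendsto_diff fun_calc_tendsto[OF A] f g p q)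
  ultimately show ?thesis
    by (rule LIMSEQ_unique)
qed

lemma tendsto_blinfun_compose:
  "(F \<longlongrightarrow> A) net \<Longrightarrow> (G \<longlongrightarrow> B) net \<Longrightarrow> ((\<lambda>n. F n o\<^sub>L G n) \<longlongrightarrow> (A o\<^sub>L B)) net"
  by (rule bounded_bilinear.tendsto[OF bounded_bilinear_blinfun_compose])

lemma bounded_image_Icc:
  fixes f :: "real \<Rightarrow> real"
  shows "continuous_on {m..M} f \<Longrightarrow> bounded (f ` {m..M})"
  by (intro compact_imp_bounded compact_continuous_image compact_Icc)

lemma fun_calc_mult:
  assumes A: "op_between m M A" and f: "continuous_on {m..M} f" and g: "continuous_on {m..M} g"
  shows "fun_calc (\<lambda>x. f x * g x) A = fun_calc f A o\<^sub>L fun_calc g A"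
proof -
  obtain p where p: "uniform_limit {m..M} (\<lambda>n. poly (p n)) f sequentially"
    using weierstrass_poly[OF f] .
  obtain q where q: "uniform_limit {m..M} (\<lambda>n. poly (q n)) g sequentially"
    using weierstrass_poly[OF g] .
  have "uniform_limit {m..M} (\<lambda>n. poly (p n * q n)) (\<lambda>x. f x * g x) sequentially"
    unfolding poly_mult[abs_def]
    by (rule uniform_lim_mult[OF p q bounded_image_Icc[OF f] bounded_image_Icc[OF g]])
  then have "(\<lambda>n. op_poly (p n * q n) A) \<longlonglongrightarrow> fun_calc (\<lambda>x. f x * g x) A"
    by (intro fun_calc_tendsto[OF A]) (intro continuous_intros f g)
  moreover have "(\<lambda>n. op_poly (p n * q n) A) \<longlonglongrightarrow> (fun_calc f A o\<^sub>L fun_calc g A)"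
    unfolding op_poly_mult
    by (intro tendsto_blinfun_compose fun_calc_tendsto[OF A] f g p q)
  ultimately show ?thesis
    by (rule LIMSEQ_unique)
qed

lemma fun_calc_intertwine:
  assumes A: "op_between m M A" and S: "op_between m M S" and f: "continuous_on {m..M} f"
    and Z: "Z o\<^sub>L A = S o\<^sub>L Z"
  shows "Z o\<^sub>L fun_calc f A = fun_calc f S o\<^sub>L Z"
proof -
  obtain q where q: "uniform_limit {m..M} (\<lambda>n. poly (q n)) f sequentially"
    using weierstrass_poly[OF f] .
  have "(\<lambda>n. Z o\<^sub>L op_poly (q n) A) \<longlonglongrightarrow> (Z o\<^sub>L fun_calc f A)"
    by (intro tendsto_blinfun_compose tendsto_const fun_calc_tendsto[OF A f q])
  moreover have "(\<lambda>n. Z o\<^sub>L op_poly (q n) A) \<longlonglongrightarrow> (fun_calc f S o\<^sub>L Z)"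
    unfolding op_poly_intertwine[OF Z]
    by (intro tendsto_blinfun_compose tendsto_const fun_calc_tendsto[OF S f q])
  ultimately show ?thesis
    by (rule LIMSEQ_unique)
qed

lemma fun_calc_mono:
  assumes A: "op_between m M A" and f: "continuous_on {m..M} f" and g: "continuous_on {m..M} g"
    and le: "\<And>x. x \<in> {m..M} \<Longrightarrow> f x \<le> g x"
  shows "fun_calc f A \<le>\<^sub>L fun_calc g A"
proof (rule loewner_leI)
  show "self_adjoint (fun_calc f A)" "self_adjoint (fun_calc g A)"
    by (rule self_adjoint_fun_calc[OF A f] self_adjoint_fun_calc[OF A g])+
  fix x
  let ?h = "\<lambda>x. sqrt \<bar>g x - f x\<bar>"
  have h: "continuous_on {m..M} ?h"
    by (intro continuous_intros f g)
  have hh: "continuous_on {m..M} (\<lambda>x. ?h x * ?h x)"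
    by (intro continuous_intros f g)
  have "fun_calc (\<lambda>x. (g x - f x) - ?h x * ?h x) A = op_poly 0 A"
    by (rule fun_calc_poly[OF A]) (simp add: le)
  then have "fun_calc g A - fun_calc f A = fun_calc ?h A o\<^sub>L fun_calc ?h A"
    by (simp only: fun_calc_diff[OF A continuous_on_diff[OF g f] hh] fun_calc_diff[OF A g f]
        fun_calc_mult[OF A h h] op_poly_0 right_minus_eq)
  then have "inner ((fun_calc g A - fun_calc f A) x) x = inner ((fun_calc ?h A o\<^sub>L fun_calc ?h A) x) x"
    by (simp only:)
  also have "\<dots> = inner (fun_calc ?h A x) (fun_calc ?h A x)"
    by (simp add: self_adjoint_inner[OF self_adjoint_fun_calc[OF A h]])
  finally have "0 \<le> inner ((fun_calc g A - fun_calc f A) x) x"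
    by (simp only: inner_ge_zero)
  then show "inner (fun_calc f A x) x \<le> inner (fun_calc g A x) x"
    by (simp add: minus_blinfun.rep_eq inner_diff_left)
qed

lemma op_between_fun_calc:
  assumes A: "op_between m M A" and f: "continuous_on {m..M} f" and le: "\<And>x. x \<in> {m..M} \<Longrightarrow> f x \<in> {a..b}"
  shows "op_between a b (fun_calc f A)"
proof -
  have c: "fun_calc (\<lambda>x. c) A = c *\<^sub>R id_blinfun" for c
    using fun_calc_poly[OF A, of "\<lambda>x. c" "[:c:]"] by simp
  have "a *\<^sub>R id_blinfun \<le>\<^sub>L fun_calc f A" "fun_calc f A \<le>\<^sub>L b *\<^sub>R id_blinfun"
    using le by (auto simp flip: c intro!: fun_calc_mono[OF A] f)
  from this[THEN loewner_leD] show ?thesis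
    by (simp add: op_between_def self_adjoint_fun_calc[OF A f] blinfun.bilinear_simps)
qed

lemma fun_calc_poly_comp:
  assumes A: "op_between m M A" and f: "continuous_on {m..M} f"
  shows "op_poly q (fun_calc f A) = fun_calc (\<lambda>x. poly q (f x)) A"
proof (induction q)
  case 0
  show ?case
    using fun_calc_poly[OF A, of "\<lambda>x. 0" 0] by simp
next
  case (pCons c q)
  have q: "continuous_on {m..M} (\<lambda>x. poly q (f x))"
    by (intro continuous_intros f)
  have c: "fun_calc (\<lambda>x. - c) A = - c *\<^sub>R id_blinfun"
    using fun_calc_poly[OF A, of "\<lambda>x. - c" "[:- c:]"] by simp
  have "fun_calc (\<lambda>x. poly (pCons c q) (f x)) A = fun_calc (\<lambda>x. f x * poly q (f x) - (- c)) A"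
    by (simp add: algebra_simps)
  also have "\<dots> = (fun_calc f A o\<^sub>L fun_calc (\<lambda>x. poly q (f x)) A) - (- c *\<^sub>R id_blinfun)"
    by (subst fun_calc_diff[OF A]) (auto intro!: continuous_intros f simp: fun_calc_mult[OF A f q] c)
  finally show ?case
    by (simp add: pCons.IH)
qed

lemma norm_fun_calc_le:
  assumes A: "op_between m M A" and f: "continuous_on {m..M} f" and e: "e \<ge> 0"
    and le: "\<And>x. x \<in> {m..M} \<Longrightarrow> \<bar>f x\<bar> \<le> e"
  shows "norm (fun_calc f A) \<le> e"
proof (rule field_le_epsilon)
  fix d :: real assume d: "d > 0"
  obtain q where q: "uniform_limit {m..M} (\<lambda>n. poly (q n)) f sequentially"
    using weierstrass_poly[OF f] .
  have "\<forall>\<^sub>F n in sequentially. norm (op_poly (q n) A) \<le> e + d"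
    using uniform_limitD[OF q d]
  proof eventually_elim
    case (elim n)
    show ?case
    proof (rule norm_op_poly_le_real_spectrum[OF op_between_self_adjoint[OF A]])
      fix x assume "x \<in> real_spectrum A"
      then have "x \<in> {m..M}"
        using real_spectrum_op_between[OF A] by blast
      with elim le[of x] show "\<bar>poly (q n) x\<bar> \<le> e + d"
        by (force simp: dist_real_def)
    qed (use d e in simp)
  qed
  with tendsto_norm[OF fun_calc_tendsto[OF A f q]] show "norm (fun_calc f A) \<le> e + d"
    by (rule tendsto_upperbound) simp
qed

lemma fun_calc_comp:
  assumes A: "op_between m M A" and f: "continuous_on {m..M} f" and le: "\<And>x. x \<in> {m..M} \<Longrightarrow> f x \<in> {a..b}"
    and g: "continuous_on {a..b} g"
  shows "fun_calc g (fun_calc f A) = fun_calc (\<lambda>x. g (f x)) A"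
proof -
  obtain q where q: "uniform_limit {a..b} (\<lambda>n. poly (q n)) g sequentially"
    using weierstrass_poly[OF g] .
  have gf: "continuous_on {m..M} (\<lambda>x. g (f x))"
    by (rule continuous_on_compose2[OF g f]) (use le in auto)
  have qf: "continuous_on {m..M} (\<lambda>x. poly (q n) (f x))" for n
    by (intro continuous_intros f)
  have "(\<lambda>n. op_poly (q n) (fun_calc f A)) \<longlonglongrightarrow> fun_calc g (fun_calc f A)"
    by (rule fun_calc_tendsto[OF op_between_fun_calc[OF A f le] g q])
  moreover have "(\<lambda>n. op_poly (q n) (fun_calc f A)) \<longlonglongrightarrow> fun_calc (\<lambda>x. g (f x)) A"
  proof (rule LIMSEQ_I)
    fix e :: real assume e: "e > 0"
    then have "e/2 > 0" by simp
    from uniform_limitD[OF q this]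
    have "\<forall>\<^sub>F n in sequentially. norm (op_poly (q n) (fun_calc f A) - fun_calc (\<lambda>x. g (f x)) A) < e"
    proof eventually_elim
      case (elim n)
      have "norm (fun_calc (\<lambda>x. poly (q n) (f x) - g (f x)) A) \<le> e/2"
      proof (rule norm_fun_calc_le[OF A])
        show "continuous_on {m..M} (\<lambda>x. poly (q n) (f x) - g (f x))"
          by (intro continuous_on_diff qf gf)
        fix x assume "x \<in> {m..M}"
        with le[OF this] elim show "\<bar>poly (q n) (f x) - g (f x)\<bar> \<le> e/2"
          by (auto simp: dist_real_def intro: less_imp_le)
      qed (use e in simp)
      with e show ?case
        by (simp add: fun_calc_poly_comp[OF A f] fun_calc_diff[OF A qf gf])
    qed
    then show "\<exists>N. \<forall>n\<ge>N. norm (op_poly (q n) (fun_calc f A) - fun_calc (\<lambda>x. g (f x)) A) < e"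
      by (simp add: eventually_sequentially)
  qed
  ultimately show ?thesis
    by (rule LIMSEQ_unique)
qed

lemma op_between_pos_def:
  assumes A: "op_between m M A" "m > 0"
  shows "pos_def A"
proof -
  have "0 \<le> inner (A x) x" for x
    using A by (meson inner_ge_zero less_imp_le mult_nonneg_nonneg op_between_def order_trans)
  then show ?thesis
    using A invertible_op_coercive[of A m]
    by (auto simp: pos_def_def pos_semidef_iff op_between_def self_adjoint_bounded_ops)
qed

lemma pos_def_op_between:
  assumes "pos_def A"
  obtains m M where "0 < m" "m \<le> M" "op_between m M A"
proof -
  obtain c where c: "c > 0" "\<And>x. c * inner x x \<le> inner (A x) x"
    using pos_semidef_invertible_coercive[of A] assms unfolding pos_def_def by metis
  have "op_between c (norm A) A"
    using assms c inner_le_norm_blinfun[of A] by (auto simp: op_between_def pos_def_def pos_semidef_iff)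
  then have "op_between c (max c (norm A)) A"
    by (rule op_between_mono) auto
  with c(1) show ?thesis
    by (intro that[of c "max c (norm A)"]) auto
qed

lemma pos_def_self_adjoint: "pos_def A \<Longrightarrow> self_adjoint A"
  by (simp add: pos_def_def pos_semidef_def)

lemma continuous_on_powr_Icc: "0 < m \<Longrightarrow> continuous_on {m..M} (\<lambda>x::real. x powr r)"
  by (intro continuous_on_powr continuous_on_id continuous_on_const) auto

lemma powr_Icc_bounds:
  fixes x :: real
  assumes "0 < m" "x \<in> {m..M}"
  shows "x powr r \<in> {min (m powr r) (M powr r) .. max (m powr r) (M powr r)}"
proof (cases "r \<ge> 0")
  case True
  then have "m powr r \<le> x powr r" "x powr r \<le> M powr r"
    using assms by (auto intro!: powr_mono2)
  then show ?thesis by auto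
next
  case False
  then have "x powr r \<le> m powr r" "M powr r \<le> x powr r"
    using assms by (auto intro!: powr_mono2')
  then show ?thesis by auto
qed

lemma pos_def_op_powr:
  assumes "pos_def A"
  shows "pos_def (op_powr A r)"
proof -
  obtain m M where A: "0 < m" "m \<le> M" "op_between m M A"
    by (rule pos_def_op_between[OF assms])
  show ?thesis
    unfolding op_powr_def
  proof (rule op_between_pos_def)
    show "op_between (min (m powr r) (M powr r)) (max (m powr r) (M powr r)) (fun_calc (\<lambda>x. x powr r) A)"
      by (rule op_between_fun_calc[OF A(3) continuous_on_powr_Icc[OF A(1)] powr_Icc_bounds[OF A(1)]])
  qed (use A in auto)
qed

lemma self_adjoint_op_powr: "pos_def A \<Longrightarrow> self_adjoint (op_powr A r)"
  by (intro pos_def_self_adjoint pos_def_op_powr)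

lemma op_powr_compose:
  assumes "pos_def A"
  shows "op_powr A r o\<^sub>L op_powr A s = op_powr A (r + s)"
proof -
  obtain m M where A: "0 < m" "m \<le> M" "op_between m M A"
    by (rule pos_def_op_between[OF assms])
  show ?thesis
    using fun_calc_mult[OF A(3) continuous_on_powr_Icc[OF A(1)] continuous_on_powr_Icc[OF A(1)]]
    by (simp add: op_powr_def powr_add)
qed

lemma op_powr_zero [simp]:
  assumes "pos_def A"
  shows "op_powr A 0 = id_blinfun"
proof -
  obtain m M where A: "0 < m" "m \<le> M" "op_between m M A"
    by (rule pos_def_op_between[OF assms])
  have "op_powr A 0 = op_poly [:1:] A"
    unfolding op_powr_def by (rule fun_calc_poly[OF A(3)]) (use A in auto)
  then show ?thesis by simp
qed

lemma op_powr_one [simp]: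
  assumes "pos_def A"
  shows "op_powr A 1 = A"
proof -
  obtain m M where A: "0 < m" "m \<le> M" "op_between m M A"
    by (rule pos_def_op_between[OF assms])
  have "op_powr A 1 = op_poly [:0, 1:] A"
    unfolding op_powr_def by (rule fun_calc_poly[OF A(3)]) (use A in auto)
  then show ?thesis by simp
qed

lemma op_powr_powr:
  assumes "pos_def A"
  shows "op_powr (op_powr A r) s = op_powr A (r * s)"
proof -
  obtain m M where A: "0 < m" "m \<le> M" "op_between m M A"
    by (rule pos_def_op_between[OF assms])
  have pos: "min (m powr r) (M powr r) > 0"
    using A by auto
  show ?thesis
    unfolding op_powr_def
    by (subst fun_calc_comp[OF A(3) continuous_on_powr_Icc[OF A(1)] powr_Icc_bounds[OF A(1)] continuous_on_powr_Icc[OF pos]])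
      (simp_all add: powr_powr)
qed

lemma op_powr_intertwine:
  assumes "pos_def A" "pos_def S" and Z: "Z o\<^sub>L A = S o\<^sub>L Z"
  shows "Z o\<^sub>L op_powr A r = op_powr S r o\<^sub>L Z"
proof -
  obtain m M where A: "0 < m" "m \<le> M" "op_between m M A"
    by (rule pos_def_op_between[OF assms(1)])
  obtain k K where S: "0 < k" "k \<le> K" "op_between k K S"
    by (rule pos_def_op_between[OF assms(2)])
  have "op_between (min m k) (max M K) A" "op_between (min m k) (max M K) S"
    using op_between_mono[OF A(3)] op_between_mono[OF S(3)] by auto
  from fun_calc_intertwine[OF this continuous_on_powr_Icc Z] show ?thesis
    using A S unfolding op_powr_def by auto
qed

lemma op_powr_is_inverse:
  assumes "pos_def A"
  shows "is_inverse (op_powr A r) (op_powr A (- r))"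
  using assms by (simp add: is_inverse_def op_powr_compose self_adjoint_op_powr self_adjoint_bounded_ops)

lemma op_inv_eq_op_powr:
  assumes "pos_def A"
  shows "op_inv A = op_powr A (- 1)"
  using op_inv_eqI[OF op_powr_is_inverse[OF assms, of 1]] assms by simp

lemma op_inv_op_inv:
  assumes "pos_def A"
  shows "op_inv (op_inv A) = A"
  using op_inv_eqI[OF op_powr_is_inverse[OF assms, of "- 1"]] assms by (simp add: op_inv_eq_op_powr)

lemma op_powr_le_id:
  assumes A: "pos_def A" and le: "A \<le>\<^sub>L id_blinfun" and r: "r \<ge> 0"
  shows "op_powr A r \<le>\<^sub>L id_blinfun"
proof -
  obtain m M where M: "0 < m" "m \<le> M" "op_between m M A"
    by (rule pos_def_op_between[OF A])
  have m1: "op_between m 1 A"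
    using M(3) loewner_leD[OF le] by (simp add: op_between_def)
  have "fun_calc (\<lambda>x. x powr r) A \<le>\<^sub>L fun_calc (\<lambda>x. 1) A"
    using M(1) r by (intro fun_calc_mono[OF m1] continuous_on_powr_Icc continuous_on_const) (auto intro: powr_le1)
  then show ?thesis
    using fun_calc_poly[OF m1, of "\<lambda>x. 1" "[:1:]"] by (simp add: op_powr_def)
qed

lemma continuous_on_op_powr:
  assumes "pos_def A"
  shows "continuous_on {a..b} (op_powr A)"
  unfolding continuous_on_iff
proof (intro ballI allI impI)
  fix s e :: real
  assume s: "s \<in> {a..b}" and e: "e > 0"
  obtain m M where A: "0 < m" "m \<le> M" "op_between m M A"
    by (rule pos_def_op_between[OF assms])
  have "uniformly_continuous_on ({a..b} \<times> {m..M}) (\<lambda>(r, x). x powr r)"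
    using A(1) by (intro compact_uniformly_continuous compact_Times compact_Icc)
      (auto simp: case_prod_beta intro!: continuous_intros)
  then obtain d where d: "d > 0" and u: "\<And>p q. p \<in> {a..b} \<times> {m..M} \<Longrightarrow> q \<in> {a..b} \<times> {m..M} \<Longrightarrow> dist p q < d \<Longrightarrow>
      dist (case p of (r, x) \<Rightarrow> x powr r) (case q of (r, x) \<Rightarrow> x powr r) < e/2"
    using e unfolding uniformly_continuous_on_def by (metis half_gt_zero)
  have "dist (op_powr A r) (op_powr A s) < e" if r: "r \<in> {a..b}" "dist r s < d" for r
  proof -
    have "norm (fun_calc (\<lambda>x. x powr r - x powr s) A) \<le> e/2"
    proof (rule norm_fun_calc_le[OF A(3)])
      show "continuous_on {m..M} (\<lambda>x. x powr r - x powr s)"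
        by (intro continuous_on_diff continuous_on_powr_Icc A)
      show "\<bar>x powr r - x powr s\<bar> \<le> e/2" if "x \<in> {m..M}" for x
        using u[of "(r, x)" "(s, x)"] r s that by (auto simp: dist_Pair_Pair dist_real_def)
    qed (use e in simp)
    then show ?thesis
      using e by (simp add: op_powr_def dist_norm fun_calc_diff[OF A(3) continuous_on_powr_Icc[OF A(1)] continuous_on_powr_Icc[OF A(1)]])
  qed
  with d show "\<exists>d>0. \<forall>r\<in>{a..b}. dist r s < d \<longrightarrow> dist (op_powr A r) (op_powr A s) < e"
    by blast
qed

subsection \<open>Operator inequalities\<close>

text \<open>Log-convexity of \<open>n \<mapsto> norm (S ^^ n x)\<close> for self-adjoint \<open>S\<close> turns boundedness of the orbit of
  \<open>x\<close> (here in the norm given by \<open>P\<close>) into \<open>norm (S x) \<le> norm x\<close>.\<close>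

lemma le_id_of_conj_le:
  fixes S P :: "'a::chilbert_space \<Rightarrow>\<^sub>L 'a"
  assumes S: "self_adjoint S" and P: "pos_def P" and le: "S o\<^sub>L P o\<^sub>L S \<le>\<^sub>L P"
  shows "S \<le>\<^sub>L id_blinfun"
proof (rule loewner_leI[OF S self_adjoint_id])
  fix x :: 'a
  obtain m M where m: "0 < m" "m \<le> M" "op_between m M P"
    by (rule pos_def_op_between[OF P])
  define y where "y n = (blinfun_apply S ^^ n) x" for n
  have y: "y 0 = x" "S (y n) = y (Suc n)" for n
    by (simp_all add: y_def)
  have "inner (P (y n)) (y n) \<le> inner (P x) x" for n
  proof (induction n)
    case (Suc n)
    have "inner (P (y (Suc n))) (y (Suc n)) = inner ((S o\<^sub>L P o\<^sub>L S) (y n)) (y n)"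
      by (simp add: self_adjoint_inner[OF S] y)
    also have "\<dots> \<le> inner (P (y n)) (y n)"
      by (rule loewner_leD[OF le])
    finally show ?case using Suc.IH by simp
  qed (simp add: y)
  then have bound: "m * (norm (y n))\<^sup>2 \<le> inner (P x) x" for n
    using m(3) unfolding op_between_def power2_norm_eq_inner by (meson order_trans)
  have convex: "(norm (y (Suc n)))\<^sup>2 \<le> norm (y n) * norm (y (Suc (Suc n)))" for n
  proof -
    have "(norm (y (Suc n)))\<^sup>2 = inner (y n) (y (Suc (Suc n)))"
      by (simp add: power2_norm_eq_inner self_adjoint_inner[OF S] flip: y(2))
    also have "\<dots> \<le> norm (y n) * norm (y (Suc (Suc n)))"
      by (rule norm_cauchy_schwarz)
    finally show ?thesis .
  qed
  have "norm (y 1) \<le> norm (y 0)"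
  proof (rule ccontr)
    assume "\<not> ?thesis"
    then have gt: "norm (y 0) < norm (y 1)" by simp
    have y0: "norm (y 0) > 0"
      using gt y(2)[of 0] by (cases "y 0 = 0") (auto simp: blinfun.zero_right)
    define \<rho> where "\<rho> = norm (y 1) / norm (y 0)"
    have \<rho>: "\<rho> > 1"
      using gt y0 by (simp add: \<rho>_def)
    have step: "norm (y n) > 0 \<and> \<rho> * norm (y n) \<le> norm (y (Suc n))" for n
    proof (induction n)
      case 0
      then show ?case using y0 by (simp add: \<rho>_def)
    next
      case (Suc n)
      then have pos: "norm (y (Suc n)) > 0"
        using \<rho> by (metis mult_pos_pos less_le_trans less_trans zero_less_one)
      have "norm (y n) * (\<rho> * norm (y (Suc n))) = (\<rho> * norm (y n)) * norm (y (Suc n))"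
        by simp
      also have "\<dots> \<le> norm (y (Suc n)) * norm (y (Suc n))"
        using Suc by (intro mult_right_mono) auto
      also have "\<dots> \<le> norm (y n) * norm (y (Suc (Suc n)))"
        using convex[of n] by (simp add: power2_eq_square)
      finally show ?case
        using pos Suc by simp
    qed
    have pow: "\<rho> ^ n * norm (y 0) \<le> norm (y n)" for n
    proof (induction n)
      case (Suc n)
      have "\<rho> ^ Suc n * norm (y 0) = \<rho> * (\<rho> ^ n * norm (y 0))"
        by simp
      also have "\<dots> \<le> \<rho> * norm (y n)"
        using Suc \<rho> by (intro mult_left_mono) auto
      finally show ?case
        using step[of n] by simp
    qed simp
    obtain n where n: "\<rho> ^ n > sqrt (inner (P x) x / m) / norm (y 0)"
      using real_arch_pow[OF \<rho>] by blast
    then have "sqrt (inner (P x) x / m) < norm (y n)"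
      using pow[of n] y0 by (simp add: divide_less_eq)
    then have "inner (P x) x / m < (norm (y n))\<^sup>2"
      by (metis norm_ge_zero not_le real_le_lsqrt real_le_rsqrt real_sqrt_le_iff)
    with bound[of n] m(1) show False
      by (simp add: divide_less_eq mult.commute)
  qed
  then have "norm (S x) \<le> norm x"
    using y by (metis One_nat_def)
  then have "norm (S x) * norm x \<le> norm x * norm x"
    by (intro mult_right_mono) auto
  with norm_cauchy_schwarz[of "S x" x] show "inner (S x) x \<le> inner (id_blinfun x) x"
    by (simp add: power2_norm_eq_inner flip: power2_eq_square)
qed

lemma op_powr_cancel [simp]:
  assumes "pos_def A"
  shows "op_powr A r o\<^sub>L (op_powr A s o\<^sub>L X) = op_powr A (r + s) o\<^sub>L X"
  by (simp add: op_powr_compose[OF assms] flip: blinfun_compose_assoc)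

lemma pos_def_conj_op_powr:
  assumes A: "pos_def A" and B: "pos_def B"
  shows "pos_def (op_powr A r o\<^sub>L B o\<^sub>L op_powr A r)"
proof -
  have sa: "self_adjoint (op_powr A r)"
    by (rule self_adjoint_op_powr[OF A])
  have "invertible_op (op_powr A r)"
    using pos_def_op_powr[OF A] by (simp add: pos_def_def)
  then have "invertible_op (op_powr A r o\<^sub>L B o\<^sub>L op_powr A r)"
    using B by (intro invertible_op_compose) (auto simp: pos_def_def)
  then show ?thesis
    using B self_adjoint_conj[OF sa, of B]
    by (simp add: pos_def_def pos_semidef_iff self_adjoint_inner[OF sa])
qed

lemma conj_op_powr_cancel:
  assumes A: "pos_def A" and "r + s = 0"
  shows "op_powr A r o\<^sub>L (op_powr A s o\<^sub>L X o\<^sub>L op_powr A s) o\<^sub>L op_powr A r = X"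
proof -
  have "s + r = 0"
    using assms(2) by simp
  then show ?thesis
    by (simp only: blinfun_compose_assoc op_powr_compose[OF A] op_powr_cancel[OF A] assms(2)
        op_powr_zero[OF A] id_blinfun_compose)
qed

lemma id_le_op_powr_minus_one:
  assumes D: "pos_def D" and le: "D \<le>\<^sub>L id_blinfun"
  shows "id_blinfun \<le>\<^sub>L op_powr D (- 1)"
proof -
  have "op_powr D (- 1 / 2) o\<^sub>L op_powr D 1 o\<^sub>L op_powr D (- 1 / 2) \<le>\<^sub>L op_powr D (- 1 / 2) o\<^sub>L id_blinfun o\<^sub>L op_powr D (- 1 / 2)"
    using le D by (intro loewner_le_conj) (simp_all add: self_adjoint_op_powr)
  then show ?thesis
    by (simp only: op_powr_compose[OF D] id_blinfun_compose) (simp add: D)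
qed

lemma inverse_conj_op_powr:
  assumes A: "pos_def A" and B: "pos_def B"
  shows "op_powr (op_powr B r o\<^sub>L A o\<^sub>L op_powr B r) (- 1) = op_powr B (- r) o\<^sub>L op_powr A (- 1) o\<^sub>L op_powr B (- r)"
proof -
  have AA: "A o\<^sub>L (op_powr A (- 1) o\<^sub>L X) = X" "op_powr A (- 1) o\<^sub>L (A o\<^sub>L X) = X" for X
    using op_powr_cancel[OF A, of 1 "- 1" X] op_powr_cancel[OF A, of "- 1" 1 X] A by simp_all
  have sa: "self_adjoint (op_powr B (- r) o\<^sub>L op_powr A (- 1) o\<^sub>L op_powr B (- r))"
    by (intro self_adjoint_conj self_adjoint_op_powr A B)
  have "is_inverse (op_powr B r o\<^sub>L A o\<^sub>L op_powr B r) (op_powr B (- r) o\<^sub>L op_powr A (- 1) o\<^sub>L op_powr B (- r))"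
    using self_adjoint_bounded_ops[OF sa] B
    by (simp add: is_inverse_def blinfun_compose_assoc AA op_powr_compose)
  from op_inv_eqI[OF this] show ?thesis
    using op_inv_eq_op_powr[OF pos_def_conj_op_powr[OF B A, of r]] by simp
qed

lemma op_powr_minus_one_antimono:
  assumes A: "pos_def A" and B: "pos_def B" and le: "A \<le>\<^sub>L B"
  shows "op_powr B (- 1) \<le>\<^sub>L op_powr A (- 1)"
proof -
  have "op_powr B (- 1 / 2) o\<^sub>L A o\<^sub>L op_powr B (- 1 / 2) \<le>\<^sub>L op_powr B (- 1 / 2) o\<^sub>L op_powr B 1 o\<^sub>L op_powr B (- 1 / 2)"
    using le B by (intro loewner_le_conj) (simp_all add: self_adjoint_op_powr)
  then have "op_powr B (- 1 / 2) o\<^sub>L A o\<^sub>L op_powr B (- 1 / 2) \<le>\<^sub>L id_blinfun"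
    unfolding op_powr_compose[OF B] by (simp add: B)
  then have "id_blinfun \<le>\<^sub>L op_powr B (1 / 2) o\<^sub>L op_powr A (- 1) o\<^sub>L op_powr B (1 / 2)"
    using id_le_op_powr_minus_one[OF pos_def_conj_op_powr[OF B A, of "- 1 / 2"]]
    by (simp add: inverse_conj_op_powr[OF A B])
  then have "op_powr B (- 1 / 2) o\<^sub>L id_blinfun o\<^sub>L op_powr B (- 1 / 2) \<le>\<^sub>L
      op_powr B (- 1 / 2) o\<^sub>L (op_powr B (1 / 2) o\<^sub>L op_powr A (- 1) o\<^sub>L op_powr B (1 / 2)) o\<^sub>L op_powr B (- 1 / 2)"
    by (intro loewner_le_conj self_adjoint_op_powr B)
  then show ?thesis
    by (simp add: conj_op_powr_cancel[OF B] op_powr_compose[OF B])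
qed

lemma loewner_heinz_midpoint:
  assumes A: "pos_def A" and B: "pos_def B"
    and r: "op_powr A r \<le>\<^sub>L op_powr B r" and s: "op_powr A s \<le>\<^sub>L op_powr B s"
  shows "op_powr A ((r + s) / 2) \<le>\<^sub>L op_powr B ((r + s) / 2)"
proof -
  define q where "q = (r + s) / 4"
  let ?S = "op_powr B (- q) o\<^sub>L op_powr A (2 * q) o\<^sub>L op_powr B (- q)"
  have "op_powr B (- r) \<le>\<^sub>L op_powr A (- r)"
    using op_powr_minus_one_antimono[OF pos_def_op_powr[OF A] pos_def_op_powr[OF B] r]
    by (simp add: op_powr_powr A B)
  from loewner_le_conj[OF this, of "op_powr A (2 * q)"]
  have "op_powr A (2 * q) o\<^sub>L op_powr B (- r) o\<^sub>L op_powr A (2 * q) \<le>\<^sub>L op_powr A (2 * q) o\<^sub>L op_powr A (- r) o\<^sub>L op_powr A (2 * q)"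
    by (simp add: self_adjoint_op_powr A)
  also have "op_powr A (2 * q) o\<^sub>L op_powr A (- r) o\<^sub>L op_powr A (2 * q) = op_powr A s"
    unfolding op_powr_compose[OF A] by (simp add: q_def field_simps)
  also note s
  finally have "op_powr A (2 * q) o\<^sub>L op_powr B (- r) o\<^sub>L op_powr A (2 * q) \<le>\<^sub>L op_powr B s" .
  from loewner_le_conj[OF this, of "op_powr B (- q)"]
  have "op_powr B (- q) o\<^sub>L (op_powr A (2 * q) o\<^sub>L op_powr B (- r) o\<^sub>L op_powr A (2 * q)) o\<^sub>L op_powr B (- q)
      \<le>\<^sub>L op_powr B (- q) o\<^sub>L op_powr B s o\<^sub>L op_powr B (- q)"
    by (simp add: self_adjoint_op_powr B)
  moreover have "- q + (s - r) / 2 + - q = - r" "- q + s + - q = (s - r) / 2"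
    by (simp_all add: q_def field_simps)
  ultimately have "?S o\<^sub>L op_powr B ((s - r) / 2) o\<^sub>L ?S \<le>\<^sub>L op_powr B ((s - r) / 2)"
    by (simp only: blinfun_compose_assoc op_powr_compose[OF B] op_powr_cancel[OF B])
  then have "?S \<le>\<^sub>L id_blinfun"
    by (intro le_id_of_conj_le[of _ "op_powr B ((s - r) / 2)"] self_adjoint_conj self_adjoint_op_powr pos_def_op_powr A B)
  from loewner_le_conj[OF this, of "op_powr B q"]
  have "op_powr A (2 * q) \<le>\<^sub>L op_powr B (2 * q)"
    by (simp add: self_adjoint_op_powr conj_op_powr_cancel op_powr_compose A B)
  moreover have "2 * q = (r + s) / 2"
    by (simp add: q_def)
  ultimately show ?thesis
    by (simp only:)
qed

theorem loewner_heinz: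
  assumes A: "pos_def A" and B: "pos_def B" and le: "A \<le>\<^sub>L B" and s: "0 \<le> s" "s \<le> 1"
  shows "op_powr A s \<le>\<^sub>L op_powr B s"
proof -
  define G where "G = {r \<in> {0..1}. op_powr A r \<le>\<^sub>L op_powr B r}"
  have "G = {0..1} \<inter> (\<Inter>x. {r \<in> {0..1}. inner (op_powr A r x) x \<le> inner (op_powr B r x) x})"
    unfolding G_def
    by (auto dest: loewner_leD intro!: loewner_leI self_adjoint_op_powr A B)
  moreover have "closed {r \<in> {0..1}. inner (op_powr A r x) x \<le> inner (op_powr B r x) x}" for x
    by (intro continuous_on_closed_Collect_le continuous_intros continuous_on_op_powr A B closed_atLeastAtMost)
  ultimately have closed: "closed G"
    by auto
  have ends: "0 \<in> G" "1 \<in> G"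
    using A B le by (auto simp: G_def)
  have mid: "(a + b) / 2 \<in> G" if "a \<in> G" "b \<in> G" for a b
    using that loewner_heinz_midpoint[OF A B] by (auto simp: G_def)
  have "s \<in> G"
  proof (rule ccontr)
    assume sG: "s \<notin> G"
    define a b where "a = Sup (G \<inter> {..s})" and "b = Inf (G \<inter> {s..})"
    have a: "a \<in> G \<inter> {..s}"
      unfolding a_def using ends s by (intro closed_contains_Sup closed_Int closed) auto
    have b: "b \<in> G \<inter> {s..}"
      unfolding b_def using ends s by (intro closed_contains_Inf closed_Int closed) auto
    have ab: "a < s" "s < b"
      using a b sG by (auto simp: less_le)
    have m: "(a + b) / 2 \<in> G"
      using a b mid by blast
    show False
    proof (cases "(a + b) / 2 \<le> s")
      case True
      then have "(a + b) / 2 \<le> a"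
        using m unfolding a_def by (intro cSup_upper) auto
      with ab show False by simp
    next
      case False
      then have "b \<le> (a + b) / 2"
        using m unfolding b_def by (intro cInf_lower) auto
      with ab show False by simp
    qed
  qed
  then show ?thesis by (simp add: G_def)
qed

lemma pos_def_geo_mean: "pos_def A \<Longrightarrow> pos_def B \<Longrightarrow> pos_def (geo_mean A B)"
  unfolding geo_mean_def by (intro pos_def_conj_op_powr pos_def_op_powr)

lemma geo_mean_riccati:
  assumes A: "pos_def A" and B: "pos_def B"
  shows "geo_mean A B o\<^sub>L op_powr A (- 1) o\<^sub>L geo_mean A B = B"
proof -
  let ?C = "op_powr A (- 1 / 2) o\<^sub>L B o\<^sub>L op_powr A (- 1 / 2)"
  have C: "pos_def ?C"
    by (rule pos_def_conj_op_powr[OF A B])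
  have "geo_mean A B o\<^sub>L op_powr A (- 1) o\<^sub>L geo_mean A B =
      op_powr A (1 / 2) o\<^sub>L (op_powr ?C (1 / 2) o\<^sub>L op_powr ?C (1 / 2)) o\<^sub>L op_powr A (1 / 2)"
    by (simp add: geo_mean_def blinfun_compose_assoc A)
  also have "\<dots> = B"
    unfolding op_powr_compose[OF C] field_sum_of_halves op_powr_one[OF C]
    by (rule conj_op_powr_cancel[OF A]) simp
  finally show ?thesis .
qed

lemma riccati_mono:
  assumes H: "pos_def H" and G: "pos_def G" and P: "pos_def P"
    and le: "H o\<^sub>L P o\<^sub>L H \<le>\<^sub>L G o\<^sub>L P o\<^sub>L G"
  shows "H \<le>\<^sub>L G"
proof -
  let ?R = "op_powr G (1 / 2)" and ?I = "op_powr G (- 1 / 2)"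
  let ?S = "?I o\<^sub>L H o\<^sub>L ?I"
  have IG: "?I o\<^sub>L (G o\<^sub>L X) = ?R o\<^sub>L X" "G o\<^sub>L ?I = ?R" for X
    using op_powr_cancel[OF G, of "- 1 / 2" 1 X] op_powr_compose[OF G, of 1 "- 1 / 2"]
    by (simp_all add: G)
  have "?I o\<^sub>L (H o\<^sub>L P o\<^sub>L H) o\<^sub>L ?I \<le>\<^sub>L ?I o\<^sub>L (G o\<^sub>L P o\<^sub>L G) o\<^sub>L ?I"
    by (intro loewner_le_conj[OF le] self_adjoint_op_powr G)
  also have "?I o\<^sub>L (H o\<^sub>L P o\<^sub>L H) o\<^sub>L ?I = ?S o\<^sub>L (?R o\<^sub>L P o\<^sub>L ?R) o\<^sub>L ?S"
    by (simp add: blinfun_compose_assoc G)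
  also have "?I o\<^sub>L (G o\<^sub>L P o\<^sub>L G) o\<^sub>L ?I = ?R o\<^sub>L P o\<^sub>L ?R"
    by (simp only: blinfun_compose_assoc IG)
  finally have "?S \<le>\<^sub>L id_blinfun"
    by (intro le_id_of_conj_le[of _ "?R o\<^sub>L P o\<^sub>L ?R"] self_adjoint_conj self_adjoint_op_powr
        pos_def_conj_op_powr pos_def_self_adjoint G P H)
  from loewner_le_conj[OF this, of ?R] show ?thesis
    by (simp add: self_adjoint_op_powr conj_op_powr_cancel op_powr_compose G)
qed

lemma ando_hiai_le_two:
  assumes A: "pos_def A" and B: "pos_def B" and le: "geo_mean A B \<le>\<^sub>L id_blinfun"
    and p: "1 \<le> p" "p \<le> 2"
  shows "geo_mean (op_powr A p) (op_powr B p) \<le>\<^sub>L id_blinfun"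
proof -
  define s where "s = p - 1"
  have s: "0 \<le> s" "s \<le> 1" "p = s + 1"
    using p by (simp_all add: s_def)
  define C where "C = op_powr A (- 1 / 2) o\<^sub>L B o\<^sub>L op_powr A (- 1 / 2)"
  let ?Y = "op_powr A (1 / 2)" and ?I = "op_powr A (- 1 / 2)" and ?K = "op_powr C (1 / 2)"
  have C: "pos_def C"
    unfolding C_def by (rule pos_def_conj_op_powr[OF A B])
  have G: "geo_mean A B = ?Y o\<^sub>L ?K o\<^sub>L ?Y"
    by (simp add: geo_mean_def C_def)
  have saY: "self_adjoint ?Y" "self_adjoint ?I"
    by (intro self_adjoint_op_powr A)+
  have saK: "self_adjoint ?K"
    by (rule self_adjoint_op_powr[OF C])
  have BC: "?Y o\<^sub>L C o\<^sub>L ?Y = B"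
    unfolding C_def by (rule conj_op_powr_cancel[OF A]) simp

  have "?I o\<^sub>L geo_mean A B o\<^sub>L ?I \<le>\<^sub>L ?I o\<^sub>L id_blinfun o\<^sub>L ?I"
    by (rule loewner_le_conj[OF le saY(2)])
  then have "?K \<le>\<^sub>L op_powr A (- 1)"
    unfolding G by (simp add: conj_op_powr_cancel op_powr_compose A)
  from op_powr_minus_one_antimono[OF pos_def_op_powr[OF C] pos_def_op_powr[OF A] this]
  have AC: "A \<le>\<^sub>L op_powr C (- 1 / 2)"
    by (simp add: op_powr_powr A C)
  from loewner_heinz[OF A pos_def_op_powr[OF C] this s(1,2)]
  have "op_powr A s \<le>\<^sub>L op_powr C (- s / 2)"
    by (simp add: op_powr_powr C)
  from loewner_le_conj[OF this saY(1)]
  have Ap: "op_powr A p \<le>\<^sub>L ?Y o\<^sub>L op_powr C (- s / 2) o\<^sub>L ?Y"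
    by (simp add: op_powr_compose A s(3) add.commute)

  let ?T = "?K o\<^sub>L A o\<^sub>L ?K"
  have T: "pos_def ?T"
    by (rule pos_def_conj_op_powr[OF C A])
  have "?T \<le>\<^sub>L ?K"
    using loewner_le_conj[OF AC saK] by (simp add: op_powr_compose C)
  from loewner_heinz[OF T pos_def_op_powr[OF C] this s(1,2)]
  have "op_powr ?T s \<le>\<^sub>L op_powr C (s / 2)"
    by (simp add: op_powr_powr C)
  from loewner_le_conj[OF loewner_le_conj[OF this saK] saY(1)]
  have Ts: "?Y o\<^sub>L (?K o\<^sub>L op_powr ?T s o\<^sub>L ?K) o\<^sub>L ?Y \<le>\<^sub>L ?Y o\<^sub>L op_powr C (1 + s / 2) o\<^sub>L ?Y"
    by (simp add: op_powr_compose C)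
  have KK: "?K o\<^sub>L (?K o\<^sub>L X) = C o\<^sub>L X" for X
    using op_powr_cancel[OF C, of "1/2" "1/2" X] C by simp
  have YY: "?Y o\<^sub>L (?Y o\<^sub>L X) = A o\<^sub>L X" for X
    using op_powr_cancel[OF A, of "1/2" "1/2" X] A by simp
  have "(?Y o\<^sub>L ?K) o\<^sub>L ?T = (?Y o\<^sub>L C o\<^sub>L ?Y) o\<^sub>L (?Y o\<^sub>L ?K)"
    by (simp only: blinfun_compose_assoc KK YY)
  from op_powr_intertwine[OF T B this[unfolded BC], of s]
  have "op_powr B s o\<^sub>L (?Y o\<^sub>L C o\<^sub>L ?Y) = ?Y o\<^sub>L (?K o\<^sub>L op_powr ?T s o\<^sub>L ?K) o\<^sub>L ?Y"
    by (metis (no_types) blinfun_compose_assoc KK)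
  then have "op_powr B p = ?Y o\<^sub>L (?K o\<^sub>L op_powr ?T s o\<^sub>L ?K) o\<^sub>L ?Y"
    using op_powr_compose[OF B, of s 1] by (simp only: BC op_powr_one[OF B] s(3))
  then have Bp: "op_powr B p \<le>\<^sub>L ?Y o\<^sub>L op_powr C (1 + s / 2) o\<^sub>L ?Y"
    using Ts by (simp only:)

  define P where "P = ?I o\<^sub>L op_powr C (s / 2) o\<^sub>L ?I"
  have P: "pos_def P"
    unfolding P_def by (intro pos_def_conj_op_powr pos_def_op_powr A C)
  define H where "H = geo_mean (op_powr A p) (op_powr B p)"
  have H: "pos_def H"
    unfolding H_def by (intro pos_def_geo_mean pos_def_op_powr A B)
  have "P \<le>\<^sub>L op_powr (op_powr A p) (- 1)"
    using op_powr_minus_one_antimono[OF pos_def_op_powr[OF A] pos_def_conj_op_powr[OF A pos_def_op_powr[OF C]] Ap]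
    by (simp add: inverse_conj_op_powr[OF pos_def_op_powr[OF C] A] op_powr_powr[OF C] P_def)
  then have "H o\<^sub>L P o\<^sub>L H \<le>\<^sub>L H o\<^sub>L op_powr (op_powr A p) (- 1) o\<^sub>L H"
    by (rule loewner_le_conj[OF _ pos_def_self_adjoint[OF H]])
  also have "\<dots> = op_powr B p"
    unfolding H_def by (intro geo_mean_riccati pos_def_op_powr A B)
  also note Bp
  also have "?Y o\<^sub>L op_powr C (1 + s / 2) o\<^sub>L ?Y = geo_mean A B o\<^sub>L P o\<^sub>L geo_mean A B"
    by (simp add: G P_def blinfun_compose_assoc A C op_powr_compose)
  finally have "H \<le>\<^sub>L geo_mean A B"
    by (rule riccati_mono[OF H pos_def_geo_mean[OF A B] P])
  also note le
  finally show ?thesis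
    by (simp add: H_def)
qed

theorem ando_hiai:
  assumes A: "pos_def A" and B: "pos_def B" and le: "geo_mean A B \<le>\<^sub>L id_blinfun" and p: "p \<ge> 1"
  shows "geo_mean (op_powr A p) (op_powr B p) \<le>\<^sub>L id_blinfun"
proof -
  have *: "geo_mean (op_powr A r) (op_powr B r) \<le>\<^sub>L id_blinfun" if "1 \<le> r" "r \<le> 2 ^ n" for n r
    using that
  proof (induction n arbitrary: r)
    case 0
    then show ?case
      using le A B by simp
  next
    case (Suc n)
    show ?case
    proof (cases "r \<le> 2")
      case True
      then show ?thesis
        using Suc.prems by (intro ando_hiai_le_two A B le)
    next
      case False
      then have "geo_mean (op_powr A (r / 2)) (op_powr B (r / 2)) \<le>\<^sub>L id_blinfun"
        using Suc.prems by (intro Suc.IH) auto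
      from ando_hiai_le_two[OF pos_def_op_powr[OF A] pos_def_op_powr[OF B] this, of 2]
      show ?thesis
        by (simp add: op_powr_powr A B)
    qed
  qed
  obtain n where "p < 2 ^ n"
    using real_arch_pow[of 2 p] by auto
  with p show ?thesis
    by (intro *[of p n]) auto
qed

theorem theorem3p8:
  fixes A B :: "'a::chilbert_space \<Rightarrow>\<^sub>L 'a" and t :: real
  assumes "pos_def A" and "pos_def B"
    and "0 < t" and "t \<le> 1"
    and "spectral_geo_mean t (op_inv A) B \<le>\<^sub>L op_inv A"
  shows "\<forall>p::real. p \<ge> 1 \<longrightarrow> geo_mean (op_powr A p) (op_powr B p) \<le>\<^sub>L id_blinfun"
proof (intro allI impI)
  fix p :: real
  assume p: "p \<ge> 1"
  let ?G = "geo_mean A B"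
  have G: "pos_def ?G"
    using assms(1,2) by (rule pos_def_geo_mean)
  have "op_powr ?G t o\<^sub>L op_inv A o\<^sub>L op_powr ?G t \<le>\<^sub>L op_inv A"
    using assms(5) by (simp add: spectral_geo_mean_def op_inv_op_inv[OF assms(1)])
  moreover have "pos_def (op_inv A)"
    by (simp add: op_inv_eq_op_powr assms(1) pos_def_op_powr)
  ultimately have "op_powr ?G t \<le>\<^sub>L id_blinfun"
    using le_id_of_conj_le[OF self_adjoint_op_powr[OF G]] by blast
  then have "op_powr (op_powr ?G t) (1 / t) \<le>\<^sub>L id_blinfun"
    using assms(3) by (intro op_powr_le_id[OF pos_def_op_powr[OF G]]) auto
  then have "?G \<le>\<^sub>L id_blinfun"
    using assms(3) G by (simp add: op_powr_powr)
  then show "geo_mean (op_powr A p) (op_powr B p) \<le>\<^sub>L id_blinfun"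
    by (rule ando_hiai[OF assms(1,2) _ p])
qed

end
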